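(* Let $X$ be a Banach space, $k\in\mathbb N$, $k\ge1$, and let $\{S(t)\}_{t\ge0}$ be a $k$-times integrated semigroup on $X$ such that $$\|S(t)\|\le M t^\alpha e^{\omega t}\qquad(t>0)$$ for some $M>0$, $\omega\ge0$ and some $\alpha$ with $k-1<\alpha\le k$. Let $R(\lambda)=\lambda^k\int_0^\infty e^{-\lambda t}S(t)\,dt$ ($\lambda>\omega$) be the associated pseudo-resolvent and define $$F(t)=t^{-1}R(t^{-1}),\qquad 0<t<\omega^{-1}$$ (with $\omega^{-1}=\infty$ if $\omega=0$). Then for every $t_0>0$, the function $t\mapsto F(t/n)^n$ is (strongly) Bochner integrable on $(0,t_0)$ for all sufficiently large $n$, and in the strong operator topology $$\lim_{n\to\infty}\int_0^{t_0}\frac{(t_0-\tau)^{k-1}}{(k-1)!}\,F(\tau/n)^n\,d\tau=S(t_0),$$ i.e. the convergence holds after applying both sides to any $x\in X$.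
   Context: For $\kappa\ge0$, a (possibly multivalued) closed linear operator $A$ on $X$ with nonempty resolvent set $\rho(A)$ generates a $\kappa$-times integrated semigroup $S$ if there exist $\omega_0\ge0$ and a strongly continuous function $S:[0,\infty)\to\mathcal L(X)$ having a Laplace transform for $\lambda>\omega_0$ such that $(\omega_0,\infty)\subset\rho(A)$ and $R(\lambda,A)=\lambda^\kappa\int_0^\infty e^{-\lambda t}S(t)\,dt$ for $\lambda>\omega_0$. Since $A$ may be multivalued, $R(\lambda)=R(\lambda,A)$ is in general a pseudo-resolvent (bounded operators satisfying the resolvent equation). Operator-valued integrals are understood as strong Bochner integrals, i.e. as Bochner integrals after application to each $x\in X$. *)

theory Defs
  imports "HOL-Analysis.Analysis"
begin

section \<open>The Bochner integral in an arbitrary Banach space\<close>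

text \<open>
  The constants \<^const>\<open>has_bochner_integral\<close>, \<^const>\<open>integrable\<close> and
  \<^const>\<open>lebesgue_integral\<close> are only available for separable (second countable) target
  spaces.  The following is the usual definition by simple functions, without separability.
  Almost-everywhere convergence of the simple functions expresses strong measurability of the
  integrand, which replaces Borel measurability.
\<close>

definition Bochner_has_integral ::
    "'b measure \<Rightarrow> ('b \<Rightarrow> 'a::real_normed_vector) \<Rightarrow> 'a \<Rightarrow> bool" where
  "Bochner_has_integral M f I \<longleftrightarrow>
     (\<exists>s :: nat \<Rightarrow> 'b \<Rightarrow> 'a.
        (\<forall>i. Bochner_Integration.simple_bochner_integrable M (s i)) \<and>
        (AE x in M. (\<lambda>i. s i x) \<longlonglongrightarrow> f x) \<and>
        (\<lambda>i. \<integral>\<^sup>+x. ennreal (norm (f x - s i x)) \<partial>M) \<longlonglongrightarrow> 0 \<and>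
        (\<lambda>i. Bochner_Integration.simple_bochner_integral M (s i)) \<longlonglongrightarrow> I)"

definition Bochner_integrable :: "'b measure \<Rightarrow> ('b \<Rightarrow> 'a::real_normed_vector) \<Rightarrow> bool" where
  "Bochner_integrable M f \<longleftrightarrow> (\<exists>I. Bochner_has_integral M f I)"

definition Bochner_integral :: "'b measure \<Rightarrow> ('b \<Rightarrow> 'a::real_normed_vector) \<Rightarrow> 'a" where
  "Bochner_integral M f = (THE I. Bochner_has_integral M f I)"

abbreviation Bochner_integrable_on :: "(real \<Rightarrow> 'a::real_normed_vector) \<Rightarrow> real set \<Rightarrow> bool" where
  "Bochner_integrable_on f D \<equiv> Bochner_integrable lborel (\<lambda>t. indicator D t *\<^sub>R f t)"

abbreviation Bochner_integral_on :: "real set \<Rightarrow> (real \<Rightarrow> 'a::real_normed_vector) \<Rightarrow> 'a" where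
  "Bochner_integral_on D f \<equiv> Bochner_integral lborel (\<lambda>t. indicator D t *\<^sub>R f t)"

lemma simple_integral_diff_le_AE_limit:
  fixes f :: "'b \<Rightarrow> 'a::real_normed_vector"
  assumes s: "\<And>i. Bochner_Integration.simple_bochner_integrable M (s i)"
    and lim: "AE x in M. (\<lambda>i. s i x) \<longlonglongrightarrow> f x"
    and u: "Bochner_Integration.simple_bochner_integrable M u" and v: "Bochner_Integration.simple_bochner_integrable M v"
  shows "ennreal (norm (Bochner_Integration.simple_bochner_integral M u - Bochner_Integration.simple_bochner_integral M v)) \<le>
    (\<integral>\<^sup>+x. norm (f x - u x) \<partial>M) + (\<integral>\<^sup>+x. norm (f x - v x) \<partial>M)"
proof -
  define h where "h w x = liminf (\<lambda>j. ennreal (norm (s j x - w x)))" for w x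
  have simple_diff: "Bochner_Integration.simple_bochner_integrable M (\<lambda>x. norm (p x - q x))"
    if "Bochner_Integration.simple_bochner_integrable M p" "Bochner_Integration.simple_bochner_integrable M q" for p q :: "'b \<Rightarrow> 'a"
    using simple_bochner_integrable_compose2[of "\<lambda>x y. norm (x - y)" M p q] that by auto
  have meas: "(\<lambda>x. ennreal (norm (p x - q x))) \<in> borel_measurable M"
    if "Bochner_Integration.simple_bochner_integrable M p" "Bochner_Integration.simple_bochner_integrable M q" for p q :: "'b \<Rightarrow> 'a"
  proof -
    have "(\<lambda>x. norm (p x - q x)) \<in> borel_measurable M"
      using simple_diff[OF that]
      by (auto intro: borel_measurable_simple_function elim: simple_bochner_integrable.cases)
    then show ?thesis by measurable
  qed
  have h_meas: "h w \<in> borel_measurable M" if "Bochner_Integration.simple_bochner_integrable M w" for w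
    unfolding h_def using meas[OF s that] by measurable
  have h_AE: "AE x in M. ennreal (norm (f x - w x)) = h w x" for w
    using lim
  proof eventually_elim
    case (elim x)
    then have "(\<lambda>j. ennreal (norm (s j x - w x))) \<longlonglongrightarrow> ennreal (norm (f x - w x))"
      by (intro tendsto_intros)
    then show ?case
      unfolding h_def by (metis lim_imp_Liminf sequentially_bot)
  qed
  have h_int: "(\<integral>\<^sup>+x. norm (f x - w x) \<partial>M) = (\<integral>\<^sup>+x. h w x \<partial>M)" for w
    by (rule nn_integral_cong_AE[OF h_AE])
  have "ennreal (norm (Bochner_Integration.simple_bochner_integral M u - Bochner_Integration.simple_bochner_integral M v))
      = norm (Bochner_Integration.simple_bochner_integral M (\<lambda>x. u x - v x))"
    using u v by (subst simple_bochner_integral_diff) auto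
  also have "\<dots> \<le> Bochner_Integration.simple_bochner_integral M (\<lambda>x. norm (u x - v x))"
    using simple_bochner_integrable_compose2[of "(-)" M u v] u v
    by (auto intro!: simple_bochner_integral_norm_bound)
  also have "\<dots> = (\<integral>\<^sup>+x. norm (u x - v x) \<partial>M)"
    using simple_diff[OF u v] by (auto intro!: simple_bochner_integral_eq_nn_integral)
  also have "\<dots> \<le> (\<integral>\<^sup>+x. h u x + h v x \<partial>M)"
  proof (rule nn_integral_mono_AE)
    show "AE x in M. ennreal (norm (u x - v x)) \<le> h u x + h v x"
      using h_AE[of u] h_AE[of v]
    proof eventually_elim
      case (elim x)
      have "norm (u x - v x) \<le> norm (f x - u x) + norm (f x - v x)"
        by (metis dual_order.refl norm_diff_triangle_le norm_minus_commute)
      then show ?case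
        by (metis elim ennreal_leI ennreal_plus norm_ge_zero)
    qed
  qed
  also have "\<dots> = (\<integral>\<^sup>+x. norm (f x - u x) \<partial>M) + (\<integral>\<^sup>+x. norm (f x - v x) \<partial>M)"
    unfolding h_int by (rule nn_integral_add) (use h_meas u v in auto)
  finally show ?thesis .
qed

lemma Bochner_has_integral_unique:
  assumes "Bochner_has_integral M f I" "Bochner_has_integral M f J"
  shows "I = J"
proof -
  obtain s where s: "\<And>i. Bochner_Integration.simple_bochner_integrable M (s i)"
      "AE x in M. (\<lambda>i. s i x) \<longlonglongrightarrow> f x"
      "(\<lambda>i. \<integral>\<^sup>+x. norm (f x - s i x) \<partial>M) \<longlonglongrightarrow> 0"
      "(\<lambda>i. Bochner_Integration.simple_bochner_integral M (s i)) \<longlonglongrightarrow> I"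
    using assms(1) unfolding Bochner_has_integral_def by blast
  obtain t where t: "\<And>i. Bochner_Integration.simple_bochner_integrable M (t i)"
      "(\<lambda>i. \<integral>\<^sup>+x. norm (f x - t i x) \<partial>M) \<longlonglongrightarrow> 0"
      "(\<lambda>i. Bochner_Integration.simple_bochner_integral M (t i)) \<longlonglongrightarrow> J"
    using assms(2) unfolding Bochner_has_integral_def by blast
  have "(\<lambda>i. ennreal (norm (Bochner_Integration.simple_bochner_integral M (s i) - Bochner_Integration.simple_bochner_integral M (t i))))
      \<longlonglongrightarrow> ennreal (norm (I - J))"
    using s(4) t(3) by (intro tendsto_intros)
  moreover have "(\<lambda>i. (\<integral>\<^sup>+x. norm (f x - s i x) \<partial>M) + (\<integral>\<^sup>+x. norm (f x - t i x) \<partial>M)) \<longlonglongrightarrow> 0 + 0"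
    using s(3) t(2) by (intro tendsto_add)
  ultimately have "ennreal (norm (I - J)) \<le> 0 + 0"
    by (rule LIMSEQ_le)
      (auto intro!: exI[of _ 0] simple_integral_diff_le_AE_limit[OF s(1,2)] s(1) t(1))
  then show ?thesis by simp
qed

lemma Bochner_integral_eq: "Bochner_has_integral M f I \<Longrightarrow> Bochner_integral M f = I"
  unfolding Bochner_integral_def by (blast intro: the_equality Bochner_has_integral_unique)

lemma has_bochner_integral_imp_Bochner_has_integral:
  fixes f :: "'b \<Rightarrow> 'a::{banach, second_countable_topology}"
  assumes f: "has_bochner_integral M f I"
  shows "Bochner_has_integral M f I"
proof -
  have [measurable]: "f \<in> borel_measurable M" and fin: "(\<integral>\<^sup>+x. norm (f x) \<partial>M) < \<infinity>"
    using f by (auto simp: has_bochner_integral_iff integrable_iff_bounded)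
  from borel_measurable_implies_sequence_metric[OF \<open>f \<in> borel_measurable M\<close>, of 0] obtain s where
    s: "\<And>i. simple_function M (s i)"
      and pw: "\<And>x. x \<in> space M \<Longrightarrow> (\<lambda>i. s i x) \<longlonglongrightarrow> f x"
      and bnd: "\<And>i x. x \<in> space M \<Longrightarrow> norm (s i x) \<le> 2 * norm (f x)"
    by (metis dist_0_norm dist_commute)
  have [measurable]: "\<And>i. s i \<in> borel_measurable M"
    using s by (rule borel_measurable_simple_function)
  have fin2: "(\<integral>\<^sup>+x. ennreal (2 * norm (f x)) \<partial>M) < \<infinity>"
    using fin by (simp add: nn_integral_cmult ennreal_mult ennreal_mult_less_top)
  have lim: "(\<lambda>i. \<integral>\<^sup>+x. norm (f x - s i x) \<partial>M) \<longlonglongrightarrow> 0"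
    by (rule nn_integral_dominated_convergence_norm[where w="\<lambda>x. 2 * norm (f x)"])
      (use pw bnd fin2 in auto)
  have sbi: "Bochner_Integration.simple_bochner_integrable M (s i)" for i
  proof (rule simple_bochner_integrableI_bounded[OF s])
    have "(\<integral>\<^sup>+x. norm (s i x) \<partial>M) \<le> (\<integral>\<^sup>+x. ennreal (2 * norm (f x)) \<partial>M)"
      by (intro nn_integral_mono ennreal_leI bnd)
    then show "(\<integral>\<^sup>+x. norm (s i x) \<partial>M) < \<infinity>" using fin2 by order
  qed
  from f obtain t where t: "\<And>i. Bochner_Integration.simple_bochner_integrable M (t i)"
      "(\<lambda>i. \<integral>\<^sup>+x. norm (f x - t i x) \<partial>M) \<longlonglongrightarrow> 0"
      "(\<lambda>i. Bochner_Integration.simple_bochner_integral M (t i)) \<longlonglongrightarrow> I"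
    by cases (rule that)
  have pwAE: "AE x in M. (\<lambda>i. s i x) \<longlonglongrightarrow> f x"
    using pw by auto
  have sum: "(\<lambda>i. (\<integral>\<^sup>+x. norm (f x - s i x) \<partial>M) + (\<integral>\<^sup>+x. norm (f x - t i x) \<partial>M)) \<longlonglongrightarrow> 0"
    using tendsto_add[OF lim t(2)] by simp
  have "(\<lambda>i. ennreal (norm (Bochner_Integration.simple_bochner_integral M (s i) -
      Bochner_Integration.simple_bochner_integral M (t i)))) \<longlonglongrightarrow> 0"
  proof (rule tendsto_sandwich[OF _ _ tendsto_const sum])
    show "\<forall>\<^sub>F i in sequentially. ennreal (norm (Bochner_Integration.simple_bochner_integral M (s i) -
        Bochner_Integration.simple_bochner_integral M (t i)))
        \<le> (\<integral>\<^sup>+x. norm (f x - s i x) \<partial>M) + (\<integral>\<^sup>+x. norm (f x - t i x) \<partial>M)"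
      by (intro always_eventually allI simple_integral_diff_le_AE_limit[OF sbi pwAE sbi t(1)])
  qed auto
  then have "(\<lambda>i. norm (Bochner_Integration.simple_bochner_integral M (s i) -
      Bochner_Integration.simple_bochner_integral M (t i))) \<longlonglongrightarrow> 0"
    by (simp add: tendsto_ennreal_iff flip: ennreal_0)
  then have "(\<lambda>i. Bochner_Integration.simple_bochner_integral M (s i)) \<longlonglongrightarrow> I"
    using t(3) by (metis Lim_transform tendsto_norm_zero_iff)
  then show ?thesis
    unfolding Bochner_has_integral_def using sbi pw lim by (auto intro!: exI[of _ s])
qed

section \<open>Multivalued operators and integrated semigroups\<close>

text \<open>
  A multivalued linear operator on the Banach space is given by its graph, a linear subspace
  of the product space.
\<close>

definition closed_mv_operator :: "('a::real_normed_vector \<times> 'a) set \<Rightarrow> bool" where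
  "closed_mv_operator A \<longleftrightarrow> subspace A \<and> closed A"

text \<open>
  The graph of the (in general multivalued) inverse of \<open>\<mu> - A\<close>.
\<close>

definition resolvent_graph :: "real \<Rightarrow> ('a::real_normed_vector \<times> 'a) set \<Rightarrow> ('a \<times> 'a) set" where
  "resolvent_graph \<mu> A = (\<lambda>(x, y). (\<mu> *\<^sub>R x - y, x)) ` A"

definition is_resolvent_at ::
    "real \<Rightarrow> ('a::real_normed_vector \<times> 'a) set \<Rightarrow> ('a \<Rightarrow>\<^sub>L 'a) \<Rightarrow> bool" where
  "is_resolvent_at \<mu> A T \<longleftrightarrow> resolvent_graph \<mu> A = {(z, blinfun_apply T z) | z. True}"

definition resolvent_set :: "('a::real_normed_vector \<times> 'a) set \<Rightarrow> real set" where
  "resolvent_set A = {\<mu>. \<exists>T. is_resolvent_at \<mu> A T}"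

definition resolvent :: "real \<Rightarrow> ('a::real_normed_vector \<times> 'a) set \<Rightarrow> ('a \<Rightarrow>\<^sub>L 'a)" where
  "resolvent \<mu> A = (THE T. is_resolvent_at \<mu> A T)"

text \<open>
  Families \<open>S : [0, \<infinity>) \<rightarrow> L(X)\<close> are represented by functions on all of \<^typ>\<open>real\<close>, whose values
  at negative arguments are never used.  All operator-valued integrals are taken strongly, that
  is, after application to a vector.
\<close>

definition has_Laplace_transform_at :: "(real \<Rightarrow> 'a::banach \<Rightarrow>\<^sub>L 'a) \<Rightarrow> real \<Rightarrow> bool" where
  "has_Laplace_transform_at S \<mu> \<longleftrightarrow>
     (\<forall>x. Bochner_integrable_on (\<lambda>t. exp (- \<mu> * t) *\<^sub>R blinfun_apply (S t) x) {0..})"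

definition Laplace_transform :: "(real \<Rightarrow> 'a::banach \<Rightarrow>\<^sub>L 'a) \<Rightarrow> real \<Rightarrow> 'a \<Rightarrow> 'a" where
  "Laplace_transform S \<mu> x =
     Bochner_integral_on {0..} (\<lambda>t. exp (- \<mu> * t) *\<^sub>R blinfun_apply (S t) x)"

definition generates_integrated_semigroup ::
    "real \<Rightarrow> ('a::banach \<times> 'a) set \<Rightarrow> (real \<Rightarrow> 'a \<Rightarrow>\<^sub>L 'a) \<Rightarrow> bool" where
  "generates_integrated_semigroup \<kappa> A S \<longleftrightarrow>
     closed_mv_operator A \<and> resolvent_set A \<noteq> {} \<and>
     (\<forall>x. continuous_on {0..} (\<lambda>t. blinfun_apply (S t) x)) \<and>
     (\<exists>\<omega>\<^sub>0\<ge>0. {\<omega>\<^sub>0<..} \<subseteq> resolvent_set A \<and>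
        (\<forall>\<mu>>\<omega>\<^sub>0. has_Laplace_transform_at S \<mu> \<and>
           (\<forall>x. blinfun_apply (resolvent \<mu> A) x = \<mu> powr \<kappa> *\<^sub>R Laplace_transform S \<mu> x)))"

definition integrated_semigroup :: "real \<Rightarrow> (real \<Rightarrow> 'a::banach \<Rightarrow>\<^sub>L 'a) \<Rightarrow> bool" where
  "integrated_semigroup \<kappa> S \<longleftrightarrow> \<kappa> \<ge> 0 \<and> (\<exists>A. generates_integrated_semigroup \<kappa> A S)"

definition assoc_pseudo_resolvent :: "nat \<Rightarrow> (real \<Rightarrow> 'a::banach \<Rightarrow>\<^sub>L 'a) \<Rightarrow> real \<Rightarrow> 'a \<Rightarrow> 'a" where
  "assoc_pseudo_resolvent k S \<mu> x = \<mu> ^ k *\<^sub>R Laplace_transform S \<mu> x"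

text \<open>
  \<open>F(t) = t\<inverse> R(t\<inverse>)\<close>.  Only the values for \<open>t > 0\<close> and \<open>\<omega> t < 1\<close> are meaningful.
  The operators \<open>R(\<mu>)\<close> and \<open>F(t)\<close> are given pointwise as maps on the space, so that the powers
  \<open>F(t)\<^sup>n\<close> are the iterates \<^term>\<open>resolvent_family k S t ^^ n\<close>.
\<close>

definition resolvent_family :: "nat \<Rightarrow> (real \<Rightarrow> 'a::banach \<Rightarrow>\<^sub>L 'a) \<Rightarrow> real \<Rightarrow> 'a \<Rightarrow> 'a" where
  "resolvent_family k S t x = inverse t *\<^sub>R assoc_pseudo_resolvent k S (inverse t) x"

end

theory Submission
  imports Defs "HOL-Real_Asymp.Real_Asymp"
begin

text \<open>
  Fix \<open>x\<close> and put \<open>f(t) = S(t)x\<close>, with Laplace transform \<open>L\<close>.  By the resolvent equation,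
  \<open>R(l)\<^sup>n x\<close> is \<open>(-1)\<^sup>n\<^sup>-\<^sup>1/(n-1)!\<close> times the derivative of order \<open>n-1\<close> of \<open>l\<^sup>k L(l)\<close>.  Substituting
  \<open>l = n/t\<close> shows that \<open>F(t/n)\<^sup>n x\<close> is the \<open>k\<close>-th derivative in \<open>t\<close> of
  \<open>G(t) = n\<^sup>n/(n-1)! t\<^sup>k\<^sup>-\<^sup>n \<integral> s\<^sup>n\<^sup>-\<^sup>1\<^sup>-\<^sup>k e\<^sup>-\<^sup>n\<^sup>s\<^sup>/\<^sup>t f(s) ds\<close>.
  The growth bound makes the \<open>j\<close>-th derivative of \<open>G\<close> of order \<open>t\<close> to the power \<open>\<alpha> - j\<close> near 0.
  Since \<open>\<alpha> > k - 1\<close>, the boundary terms in Taylor's formula vanish there, and the integral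
  in the theorem equals \<open>G(t\<^sub>0)\<close>.  The kernel of \<open>G(t\<^sub>0)\<close> is an approximate identity
  concentrating at \<open>t\<^sub>0\<close> (its second moments about \<open>t\<^sub>0\<close>, even with an exponential weight, tend
  to 0), so \<open>G(t\<^sub>0)\<close> tends to \<open>f(t\<^sub>0)\<close>.
\<close>

section \<open>Bochner integrals of continuous functions as limits of Henstock-Kurzweil
  integrals\<close>

lemma simple_bochner_indicator:
  fixes c :: "'a::real_normed_vector" and a b :: real
  assumes "a \<le> b"
  shows "Bochner_Integration.simple_bochner_integrable lborel (\<lambda>x. indicator {a..<b} x *\<^sub>R c)"
    and "Bochner_Integration.simple_bochner_integral lborel (\<lambda>x. indicator {a..<b} x *\<^sub>R c)
      = (b - a) *\<^sub>R c"
proof -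
  have r: "Bochner_Integration.simple_bochner_integrable lborel (indicator {a..<b} :: real \<Rightarrow> real)"
    by (rule simple_bochner_integrableI_bounded)
      (use assms in \<open>auto simp: ennreal_indicator\<close>)
  have "emeasure lborel {x. indicator {a..<b} x *\<^sub>R c \<noteq> 0} \<le> emeasure lborel {a..<b}"
    by (intro emeasure_mono) (auto simp: indicator_def)
  then have fin: "emeasure lborel {x. indicator {a..<b} x *\<^sub>R c \<noteq> 0} \<noteq> \<infinity>"
    using assms by (auto simp: top_unique)
  show "Bochner_Integration.simple_bochner_integrable lborel (\<lambda>x. indicator {a..<b} x *\<^sub>R c)"
    using fin simple_function_compose1[of lborel "indicator {a..<b} :: real \<Rightarrow> real" "\<lambda>r. r *\<^sub>R c"]
    by (intro simple_bochner_integrable.intros) auto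
  have "Bochner_Integration.simple_bochner_integral lborel (\<lambda>x. indicator {a..<b} x *\<^sub>R c)
      = Bochner_Integration.simple_bochner_integral lborel (indicator {a..<b} :: real \<Rightarrow> real) *\<^sub>R c"
    by (rule simple_bochner_integral_linear[OF _ r])
      (auto intro!: linearI simp: scaleR_add_left)
  also have "Bochner_Integration.simple_bochner_integral lborel (indicator {a..<b} :: real \<Rightarrow> real) = b - a"
  proof -
    have "ennreal (Bochner_Integration.simple_bochner_integral lborel (indicator {a..<b} :: real \<Rightarrow> real))
        = ennreal (b - a)"
      using simple_bochner_integral_eq_nn_integral[OF r] assms by (simp add: ennreal_indicator)
    then show ?thesis
      using assms by (subst (asm) ennreal_inj)
        (auto intro!: sum_nonneg simp: Bochner_Integration.simple_bochner_integral_def)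
  qed
  finally show "Bochner_Integration.simple_bochner_integral lborel (\<lambda>x. indicator {a..<b} x *\<^sub>R c)
      = (b - a) *\<^sub>R c" .
qed

text \<open>Links the simple functions of \<open>Bochner_has_integral\<close> with the
  Henstock-Kurzweil integral, for which Taylor's formula is at hand in every Banach space. Intervals
  are half-open so that steps on adjacent pieces add up without overlap.\<close>

lemma continuous_step_approximation:
  fixes g :: "real \<Rightarrow> 'a::banach"
  assumes ab: "a \<le> b" and g: "continuous_on {a..b} g" and e: "e > 0"
  obtains u where "Bochner_Integration.simple_bochner_integrable lborel u"
    "\<And>x. x \<in> {a..<b} \<Longrightarrow> norm (g x - u x) \<le> e" "\<And>x. x \<notin> {a..<b} \<Longrightarrow> u x = 0"
    "norm (Bochner_Integration.simple_bochner_integral lborel u - integral {a..b} g) \<le> e * (b - a)"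
proof -
  define Q where "Q c d \<longleftrightarrow> (\<exists>u. Bochner_Integration.simple_bochner_integrable lborel u \<and>
    (\<forall>x\<in>{c..<d}. norm (g x - u x) \<le> e) \<and> (\<forall>x. x \<notin> {c..<d} \<longrightarrow> u x = 0) \<and>
    norm (Bochner_Integration.simple_bochner_integral lborel u - integral {c..d} g) \<le> e * (d - c))" for c d
  \<comment> \<open>Bisection: \<open>Q\<close> is additive over adjacent intervals and holds on short ones.\<close>
  have "a \<le> a \<longrightarrow> b \<le> b \<longrightarrow> Q a b"
  proof (rule Bolzano[OF ab, where P="\<lambda>c d. a \<le> c \<longrightarrow> d \<le> b \<longrightarrow> Q c d"])
    fix c d r
    assume Q1: "a \<le> c \<longrightarrow> d \<le> b \<longrightarrow> Q c d" and Q2: "a \<le> d \<longrightarrow> r \<le> b \<longrightarrow> Q d r"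
      and le: "c \<le> d" "d \<le> r"
    show "a \<le> c \<longrightarrow> r \<le> b \<longrightarrow> Q c r"
    proof (intro impI)
      assume in_ab: "a \<le> c" "r \<le> b"
      with Q1 Q2 le have "Q c d" "Q d r" by auto
      then obtain u v where
        u: "Bochner_Integration.simple_bochner_integrable lborel u"
          "\<forall>x\<in>{c..<d}. norm (g x - u x) \<le> e" "\<forall>x. x \<notin> {c..<d} \<longrightarrow> u x = 0"
          "norm (Bochner_Integration.simple_bochner_integral lborel u - integral {c..d} g) \<le> e * (d - c)" and
        v: "Bochner_Integration.simple_bochner_integrable lborel v"
          "\<forall>x\<in>{d..<r}. norm (g x - v x) \<le> e" "\<forall>x. x \<notin> {d..<r} \<longrightarrow> v x = 0"
          "norm (Bochner_Integration.simple_bochner_integral lborel v - integral {d..r} g) \<le> e * (r - d)"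
        unfolding Q_def by metis
      have "g integrable_on {c..r}"
        by (intro integrable_continuous_real continuous_on_subset[OF g]) (use in_ab in auto)
      then have I: "integral {c..r} g = integral {c..d} g + integral {d..r} g"
        using le by (simp add: Henstock_Kurzweil_Integration.integral_combine)
      have "norm (Bochner_Integration.simple_bochner_integral lborel (\<lambda>x. u x + v x) - integral {c..r} g)
          \<le> e * (d - c) + e * (r - d)"
        unfolding I simple_bochner_integral_add[OF u(1) v(1)]
        using norm_triangle_mono[OF u(4) v(4)] by (simp add: algebra_simps)
      moreover have "Bochner_Integration.simple_bochner_integrable lborel (\<lambda>x. u x + v x)"
        using simple_bochner_integrable_compose2[of "(+)" lborel u v] u v by auto
      ultimately show "Q c r"
        unfolding Q_def
      proof (intro exI[of _ "\<lambda>x. u x + v x"] conjI ballI allI impI)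
        fix x assume "x \<in> {c..<r}"
        then show "norm (g x - (u x + v x)) \<le> e"
          using u(2,3) v(2,3) le by (cases "x < d") auto
      qed (use u(3) v(3) le in \<open>auto simp: algebra_simps\<close>)
    qed
  next
    fix x assume x: "a \<le> x" "x \<le> b"
    then obtain d where d: "d > 0" "\<And>y. y \<in> {a..b} \<Longrightarrow> dist y x < d \<Longrightarrow> dist (g y) (g x) < e"
      using g[unfolded continuous_on_iff, rule_format, of x e] e by auto
    show "\<exists>d>0. \<forall>p q. p \<le> x \<and> x \<le> q \<and> q - p < d \<longrightarrow> a \<le> p \<longrightarrow> q \<le> b \<longrightarrow> Q p q"
    proof (intro exI[of _ d] conjI allI impI d(1))
      fix p q assume *: "p \<le> x \<and> x \<le> q \<and> q - p < d" and pq: "a \<le> p" "q \<le> b"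
      have near: "norm (g y - g x) \<le> e" if "y \<in> {p..q}" for y
        using d(2)[of y] that * pq by (auto simp: dist_norm abs_if intro: less_imp_le)
      have gi: "g integrable_on {p..q}"
        by (intro integrable_continuous_real continuous_on_subset[OF g]) (use pq in auto)
      have "norm (integral {p..q} (\<lambda>y. g y - g x)) \<le> e * (q - p)"
        by (rule integral_bound) (use near * pq in \<open>auto intro!: continuous_intros continuous_on_subset[OF g]\<close>)
      also have "integral {p..q} (\<lambda>y. g y - g x) = integral {p..q} g - (q - p) *\<^sub>R g x"
        using gi * by (subst Henstock_Kurzweil_Integration.integral_diff) auto
      finally show "Q p q"
        unfolding Q_def using near * simple_bochner_indicator[of p q "g x"]
        by (intro exI[of _ "\<lambda>y. indicator {p..<q} y *\<^sub>R g x"]) (auto simp: norm_minus_commute)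
    qed
  qed
  then show ?thesis
    unfolding Q_def using that by blast
qed

text \<open>Step functions approximate \<open>g\<close> on the exhausting intervals; what lies
  outside is dominated by the tail of \<open>h\<close>. This serves both the half-line of the
  Laplace transform and the interval from 0 to \<open>t0\<close>, where the integrand may be
  singular at 0.\<close>

lemma Bochner_has_integral_improper:
  fixes g :: "real \<Rightarrow> 'a::banach"
  assumes ab: "\<And>n. a n \<le> b n" and cont: "\<And>n. continuous_on {a n..b n} g"
    and sub: "\<And>n. {a n..<b n} \<subseteq> D"
    and exh: "\<And>x. x \<in> D \<Longrightarrow> \<forall>\<^sub>F n in sequentially. x \<in> {a n..<b n}"
    and h: "integrable lborel (\<lambda>x. indicator D x * h x)"
    and gh: "\<And>x. x \<in> D \<Longrightarrow> norm (g x) \<le> h x"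
  obtains I where "Bochner_has_integral lborel (\<lambda>x. indicator D x *\<^sub>R g x) I"
    "(\<lambda>n. integral {a n..b n} g) \<longlonglongrightarrow> I"
proof -
  \<comment> \<open>Tolerance divided by length: the intervals may grow, yet both the pointwise
    error \<open>e n\<close> and its integral over the interval stay below
    \<open>1 / (n + 1)\<close>. The summand 1 covers intervals of length 0.\<close>
  define e where "e n = 1 / (real (Suc n) * (1 + (b n - a n)))" for n
  have e_pos: "e n > 0" for n
    unfolding e_def using ab[of n] by (intro divide_pos_pos mult_pos_pos) auto
  have e_le: "e n * (b n - a n) \<le> 1 / real (Suc n)" "e n \<le> 1 / real (Suc n)" for n
  proof -
    have c: "1 + (b n - a n) \<ge> 1" using ab[of n] by simp
    have "e n * (b n - a n) = 1 / real (Suc n) * ((b n - a n) / (1 + (b n - a n)))"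
      by (simp add: e_def)
    also have "\<dots> \<le> 1 / real (Suc n) * 1"
      using c by (intro mult_left_mono) (auto simp: divide_le_eq)
    finally show "e n * (b n - a n) \<le> 1 / real (Suc n)" by simp
    have "e n = 1 / real (Suc n) * (1 / (1 + (b n - a n)))"
      by (simp add: e_def)
    also have "\<dots> \<le> 1 / real (Suc n) * 1"
      using c by (intro mult_left_mono) (auto simp: divide_le_eq)
    finally show "e n \<le> 1 / real (Suc n)" by simp
  qed
  have lim0: "(\<lambda>n. 1 / real (Suc n)) \<longlonglongrightarrow> 0"
    by real_asymp
  have e_lim: "(\<lambda>n. e n) \<longlonglongrightarrow> 0" "(\<lambda>n. e n * (b n - a n)) \<longlonglongrightarrow> 0"
    by (rule tendsto_sandwich[OF _ _ tendsto_const lim0];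
        use e_le e_pos ab in \<open>auto intro!: always_eventually mult_nonneg_nonneg less_imp_le[OF e_pos]\<close>)+
  have "\<exists>u. Bochner_Integration.simple_bochner_integrable lborel u \<and>
    (\<forall>x\<in>{a n..<b n}. norm (g x - u x) \<le> e n) \<and> (\<forall>x. x \<notin> {a n..<b n} \<longrightarrow> u x = 0) \<and>
    norm (Bochner_Integration.simple_bochner_integral lborel u - integral {a n..b n} g) \<le> e n * (b n - a n)" for n
    by (rule continuous_step_approximation[OF ab cont e_pos]) blast
  then obtain s where s: "\<And>n. Bochner_Integration.simple_bochner_integrable lborel (s n)"
    and s_near: "\<And>n x. x \<in> {a n..<b n} \<Longrightarrow> norm (g x - s n x) \<le> e n"
    and s_0: "\<And>n x. x \<notin> {a n..<b n} \<Longrightarrow> s n x = 0"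
    and s_int: "\<And>n. norm (Bochner_Integration.simple_bochner_integral lborel (s n) - integral {a n..b n} g)
      \<le> e n * (b n - a n)"
    by metis
  define G where "G x = indicator D x *\<^sub>R g x" for x
  have pw: "(\<lambda>n. s n x) \<longlonglongrightarrow> G x" for x
  proof (cases "x \<in> D")
    case True
    have "(\<lambda>n. s n x - G x) \<longlonglongrightarrow> 0"
      by (rule Lim_null_comparison[OF _ e_lim(1)])
        (use exh[OF True] in \<open>eventually_elim, use s_near True in \<open>auto simp: G_def norm_minus_commute\<close>\<close>)
    then show ?thesis by (simp add: LIM_zero_iff)
  next
    case False
    then have "s n x = 0" for n
      using sub[of n] by (intro s_0) auto
    with False show ?thesis by (simp add: G_def)
  qed
  \<comment> \<open>The part of the majorant missed by the n-th interval, where \<open>s n\<close>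
    is 0.\<close>
  define w where "w n x = indicator (- {a n..<b n}) x * (indicator D x * h x)" for n x
  have w_meas: "w n \<in> borel_measurable lborel" for n
    unfolding w_def using borel_measurable_integrable[OF h] by measurable
  have h0: "0 \<le> indicator D x * h x" for x
    using gh[of x] by (auto simp: indicator_def intro: order_trans[OF norm_ge_zero])
  have err: "(\<integral>\<^sup>+x. norm (G x - s n x) \<partial>lborel) \<le> ennreal (1 / real (Suc n)) + (\<integral>\<^sup>+x. w n x \<partial>lborel)" for n
  proof -
    have "(\<integral>\<^sup>+x. norm (G x - s n x) \<partial>lborel) \<le>
        (\<integral>\<^sup>+x. ennreal (e n) * indicator {a n..<b n} x + w n x \<partial>lborel)"
    proof (intro nn_integral_mono)
      fix x
      show "ennreal (norm (G x - s n x)) \<le> ennreal (e n) * indicator {a n..<b n} x + ennreal (w n x)"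
        using s_near[of x n] s_0[of x n] sub[of n] gh[of x]
        by (auto simp: G_def w_def indicator_def subset_iff intro!: ennreal_leI split: if_splits)
    qed
    also have "\<dots> = ennreal (e n) * ennreal (b n - a n) + (\<integral>\<^sup>+x. w n x \<partial>lborel)"
      using w_meas ab by (subst nn_integral_add) (auto simp: nn_integral_cmult)
    also have "ennreal (e n) * ennreal (b n - a n) \<le> ennreal (1 / real (Suc n))"
      using e_le(1)[of n] e_pos[of n] ab[of n] by (simp add: ennreal_leI flip: ennreal_mult)
    finally show ?thesis by (simp add: add_right_mono)
  qed
  have "(\<lambda>n. \<integral>\<^sup>+x. w n x \<partial>lborel) \<longlonglongrightarrow> (\<integral>\<^sup>+(x::real). 0 \<partial>lborel)"
  proof (rule nn_integral_dominated_convergence[where u="\<lambda>n x. ennreal (w n x)" and u'="\<lambda>_. 0"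
        and w="\<lambda>x. ennreal (indicator D x * h x)"])
    show "(\<integral>\<^sup>+ x. ennreal (indicator D x * h x) \<partial>lborel) < \<infinity>"
      using h h0 by (auto simp: real_integrable_def less_top)
    show "AE x in lborel. (\<lambda>n. ennreal (w n x)) \<longlonglongrightarrow> 0"
    proof (rule AE_I2)
      fix x
      have "\<forall>\<^sub>F n in sequentially. ennreal (w n x) = 0"
      proof (cases "x \<in> D")
        case True
        from exh[OF True] show ?thesis by eventually_elim (auto simp: w_def)
      qed (auto simp: w_def)
      then show "(\<lambda>n. ennreal (w n x)) \<longlonglongrightarrow> 0" by (rule tendsto_eventually)
    qed
    show "(\<lambda>x. ennreal (indicator D x * h x)) \<in> borel_measurable lborel"
      using borel_measurable_integrable[OF h] by measurable
    show "(\<lambda>x. ennreal (w n x)) \<in> borel_measurable lborel" for n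
      using w_meas[of n] by measurable
    have "w n x \<le> indicator D x * h x" for n x
      using h0[of x] by (auto simp: w_def indicator_def)
    then show "AE x in lborel. ennreal (w n x) \<le> ennreal (indicator D x * h x)" for n
      by (intro AE_I2 ennreal_leI)
  qed simp
  then have "(\<lambda>n. \<integral>\<^sup>+x. w n x \<partial>lborel) \<longlonglongrightarrow> 0" by simp
  from tendsto_add[OF tendsto_ennrealI[OF lim0] this]
  have lim_bound: "(\<lambda>n. ennreal (1 / real (Suc n)) + (\<integral>\<^sup>+x. w n x \<partial>lborel)) \<longlonglongrightarrow> 0"
    by simp
  have err_lim: "(\<lambda>n. \<integral>\<^sup>+x. norm (G x - s n x) \<partial>lborel) \<longlonglongrightarrow> 0"
    by (rule tendsto_sandwich[OF _ _ tendsto_const lim_bound]) (use err in \<open>auto intro!: always_eventually\<close>)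
  let ?J = "\<lambda>n. Bochner_Integration.simple_bochner_integral lborel (s n)"
  \<comment> \<open>No candidate for the integral is known in advance; it comes from completeness of
    the space, the L1 distance to \<open>G\<close> controlling the differences of the simple
    integrals.\<close>
  have "Cauchy ?J"
  proof (rule metric_CauchyI)
    fix r :: real assume r: "r > 0"
    then have "\<forall>\<^sub>F n in sequentially. (\<integral>\<^sup>+x. norm (G x - s n x) \<partial>lborel) < ennreal (r / 3)"
      using err_lim by (intro order_tendstoD) auto
    then obtain N where N: "\<And>n. n \<ge> N \<Longrightarrow> (\<integral>\<^sup>+x. norm (G x - s n x) \<partial>lborel) < ennreal (r / 3)"
      by (auto simp: eventually_sequentially)
    have "dist (?J m) (?J n) < r" if "m \<ge> N" "n \<ge> N" for m n
    proof -
      have "ennreal (norm (?J m - ?J n))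
          \<le> (\<integral>\<^sup>+x. norm (G x - s m x) \<partial>lborel) + (\<integral>\<^sup>+x. norm (G x - s n x) \<partial>lborel)"
        by (rule simple_integral_diff_le_AE_limit[where s = s, OF s _ s s]) (use pw in auto)
      also have "\<dots> \<le> ennreal (r / 3) + ennreal (r / 3)"
        using N that by (intro add_mono less_imp_le) auto
      also have "\<dots> = ennreal (2 * r / 3)"
        using r by (simp flip: ennreal_plus)
      finally show ?thesis
        using r by (simp add: dist_norm)
    qed
    then show "\<exists>M. \<forall>m\<ge>M. \<forall>n\<ge>M. dist (?J m) (?J n) < r" by blast
  qed
  then obtain I where I: "?J \<longlonglongrightarrow> I"
    using Cauchy_convergent_iff convergent_def by blast
  have "(\<lambda>n. ?J n - integral {a n..b n} g) \<longlonglongrightarrow> 0"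
    by (rule Lim_null_comparison[OF _ e_lim(2)]) (use s_int in auto)
  then have "(\<lambda>n. integral {a n..b n} g) \<longlonglongrightarrow> I"
    by (rule Lim_transform2[OF I])
  moreover have "Bochner_has_integral lborel G I"
    unfolding Bochner_has_integral_def using s pw err_lim I by (intro exI[of _ s]) auto
  ultimately show ?thesis
    using that by (simp add: G_def[abs_def])
qed

text \<open>Every sequence of upper bounds tending to infinity yields some Bochner integral of the
  same function. Uniqueness makes all these limits equal, so the limit along \<open>at_top\<close>
  exists, which gives integrability over the whole half-line.\<close>

lemma Bochner_has_integral_half_line:
  fixes g :: "real \<Rightarrow> 'a::banach"
  assumes g: "continuous_on {0..} g"
    and h: "integrable lborel (\<lambda>x. indicator {0..} x * h x)"
    and gh: "\<And>x. x \<ge> 0 \<Longrightarrow> norm (g x) \<le> h x"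
  shows "g integrable_on {0..}"
    and "Bochner_has_integral lborel (\<lambda>x. indicator {0..} x *\<^sub>R g x) (integral {0..} g)"
proof -
  have *: "\<exists>I. Bochner_has_integral lborel (\<lambda>x. indicator {0..} x *\<^sub>R g x) I \<and>
      (\<lambda>n. integral {0..b n} g) \<longlonglongrightarrow> I"
    if b: "\<And>n. b n \<ge> 0" "filterlim b at_top sequentially" for b :: "nat \<Rightarrow> real"
  proof (rule Bochner_has_integral_improper[of "\<lambda>_. 0" b g "{0..}" h])
    show "\<forall>\<^sub>F n in sequentially. x \<in> {0..<b n}" if "x \<in> {0..}" for x
      using b(2)[unfolded filterlim_at_top_dense, rule_format, of x]
      by eventually_elim (use that in auto)
  qed (use b g h gh in \<open>auto intro: continuous_on_subset\<close>)
  from *[of real] obtain I where I: "Bochner_has_integral lborel (\<lambda>x. indicator {0..} x *\<^sub>R g x) I"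
    using filterlim_real_sequentially by auto
  have lim: "((\<lambda>b. integral {0..b} g) \<longlongrightarrow> I) at_top"
  proof (rule tendsto_at_topI_sequentially)
    fix X :: "nat \<Rightarrow> real" assume X: "filterlim X at_top sequentially"
    \<comment> \<open>\<open>X\<close> may start with negative values; cutting it off at 0 changes
      only finitely many terms.\<close>
    have ev: "\<forall>\<^sub>F n in sequentially. max 0 (X n) = X n"
      using X[unfolded filterlim_at_top, rule_format, of 0] by eventually_elim auto
    have "filterlim (\<lambda>n. max 0 (X n)) at_top sequentially"
      using X filterlim_cong[OF refl refl ev] by metis
    then obtain J where J: "Bochner_has_integral lborel (\<lambda>x. indicator {0..} x *\<^sub>R g x) J"
        "(\<lambda>n. integral {0..max 0 (X n)} g) \<longlonglongrightarrow> J"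
      using *[of "\<lambda>n. max 0 (X n)"] by auto
    have "J = I"
      using Bochner_has_integral_unique[OF J(1) I] .
    moreover have "\<forall>\<^sub>F n in sequentially. integral {0..max 0 (X n)} g = integral {0..X n} g"
      using ev by eventually_elim simp
    ultimately show "(\<lambda>n. integral {0..X n} g) \<longlonglongrightarrow> I"
      using J(2) tendsto_cong by force
  qed
  have "(g has_integral I) {0..}"
    unfolding has_integral_alt'
  proof (intro conjI allI impI)
    fix a b :: real
    have "g integrable_on {max a 0..b}"
      by (intro integrable_continuous_real continuous_on_subset[OF g]) auto
    moreover have "cbox a b \<inter> {0..} = {max a 0..b}" by auto
    ultimately show "(\<lambda>x. if x \<in> {0..} then g x else 0) integrable_on cbox a b"
      using integrable_restrict_Int[of "{0..}" g "cbox a b"] by (simp add: Int_commute max.commute)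
  next
    fix e :: real assume "e > 0"
    then obtain B where B: "\<And>b. b \<ge> B \<Longrightarrow> norm (integral {0..b} g - I) < e"
      using lim by (auto simp: tendsto_iff eventually_at_top_linorder dist_norm)
    show "\<exists>B>0. \<forall>a b. ball 0 B \<subseteq> cbox a b \<longrightarrow>
        norm (integral (cbox a b) (\<lambda>x. if x \<in> {0..} then g x else 0) - I) < e"
    \<comment> \<open>The ball is open, so doubling the radius puts \<open>max B 1\<close> inside it
      and hence \<open>B\<close> below \<open>b\<close>.\<close>
    proof (intro exI[of _ "2 * max B 1"] conjI allI impI)
      fix a b :: real assume sub: "ball 0 (2 * max B 1) \<subseteq> cbox a b"
      have "max B 1 \<in> ball (0::real) (2 * max B 1)" "0 \<in> ball (0::real) (2 * max B 1)"
        by (auto simp: dist_norm)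
      then have "max B 1 \<in> cbox a b" "0 \<in> cbox a b"
        using sub by blast+
      then have "B \<le> b" "0 \<le> b" "a \<le> 0" by auto
      moreover from this have "{0..} \<inter> {a..b} = {0..b}" by auto
      ultimately show "norm (integral (cbox a b) (\<lambda>x. if x \<in> {0..} then g x else 0) - I) < e"
        using B[of b] integral_restrict_Int[of "{a..b}" "{0..}" g] by simp
    qed auto
  qed
  then show "g integrable_on {0..}"
    and "Bochner_has_integral lborel (\<lambda>x. indicator {0..} x *\<^sub>R g x) (integral {0..} g)"
    using I by (auto simp: has_integral_iff)
qed

section \<open>Gamma integrals\<close>

text \<open>Euler's integral rescaled by \<open>a\<close>. Negative exponents above -1 are included
  because the majorant in \<open>Bochner_V\<close> may blow up at 0.\<close>

lemma has_bochner_integral_Gamma_kernel: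
  fixes a s :: real
  assumes a: "a > 0" and s: "s > -1"
  shows "has_bochner_integral lborel (\<lambda>t. indicator {0..} t * (t powr s * exp (- a * t)))
    (Gamma (s + 1) / a powr (s + 1))"
proof -
  have G: "Gamma (s + 1) > 0" using s by (intro Gamma_real_pos) auto
  have "has_bochner_integral lborel (\<lambda>t. indicator {0..} t * t powr s / exp t) (Gamma (s + 1))"
  proof (rule has_bochner_integral_nn_integral)
    show "(\<integral>\<^sup>+ t. ennreal (indicator {0..} t * t powr s / exp t) \<partial>lborel) = ennreal (Gamma (s + 1))"
      using Gamma_conv_nn_integral_real[of "s + 1"] s by simp
  qed (use G in auto)
  then have "has_bochner_integral lborel (\<lambda>t. indicator {0..} (0 + a * t) * (0 + a * t) powr s / exp (0 + a * t))
      (Gamma (s + 1) /\<^sub>R \<bar>a\<bar>)"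
    using a by (subst (asm) lborel_has_bochner_integral_real_affine_iff[where c = a and t = 0]) auto
  then have "has_bochner_integral lborel
      (\<lambda>t. (1 / a powr s) * (indicator {0..} (0 + a * t) * (0 + a * t) powr s / exp (0 + a * t)))
      ((1 / a powr s) * (Gamma (s + 1) /\<^sub>R \<bar>a\<bar>))"
    by (intro has_bochner_integral_mult_right) auto
  moreover have "(1 / a powr s) * (indicator {0..} (0 + a * t) * (0 + a * t) powr s / exp (0 + a * t))
      = indicator {0..} t * (t powr s * exp (- a * t))" for t
    using a by (auto simp: indicator_def powr_mult exp_minus field_simps zero_le_mult_iff)
  moreover have "(1 / a powr s) * (Gamma (s + 1) /\<^sub>R \<bar>a\<bar>) = Gamma (s + 1) / a powr (s + 1)"
    using a by (simp add: powr_add field_simps)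
  ultimately show ?thesis by simp
qed

lemma has_integral_Gamma_kernel:
  fixes a s :: real
  assumes a: "a > 0" and s: "s > -1"
  shows "((\<lambda>t. t powr s * exp (- a * t)) has_integral Gamma (s + 1) / a powr (s + 1)) {0..}"
proof -
  have "((\<lambda>t. indicator {0..} t * (t powr s * exp (- a * t))) has_integral Gamma (s + 1) / a powr (s + 1)) UNIV"
    using has_bochner_integral_Gamma_kernel[OF assms]
      has_integral_integral_lborel[of "\<lambda>t. indicator {0..} t * (t powr s * exp (- a * t))"]
    unfolding has_bochner_integral_iff by simp
  moreover have "(\<lambda>t. indicator {0..} t * (t powr s * exp (- a * t)))
      = (\<lambda>t. if t \<in> {0..} then t powr s * exp (- a * t) else 0)"
    by (auto simp: indicator_def)
  ultimately show ?thesis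
    using has_integral_restrict_UNIV[of "{0..}" "\<lambda>t. t powr s * exp (- a * t)"] by simp
qed

section \<open>Differentiation of Laplace transforms under a growth bound\<close>

text \<open>A quadratic remainder bound is what direct estimates supply, both for the Laplace
  transform and for pseudo-resolvents.\<close>

lemma has_vector_derivative_quadratic:
  fixes F :: "real \<Rightarrow> 'a::real_normed_vector"
  assumes d: "d > 0" and K: "K \<ge> 0"
    and F: "\<And>y. \<bar>y - x\<bar> < d \<Longrightarrow> norm (F y - F x - (y - x) *\<^sub>R D) \<le> K * (y - x)\<^sup>2"
  shows "(F has_vector_derivative D) (at x)"
  unfolding has_vector_derivative_def has_derivative_at_alt
proof (intro conjI allI impI bounded_linear_scaleR_left)
  fix e :: real assume e: "e > 0"
  show "\<exists>r>0. \<forall>y. norm (y - x) < r \<longrightarrow> norm (F y - F x - (y - x) *\<^sub>R D) \<le> e * norm (y - x)"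
  proof (intro exI[of _ "min d (e / (K + 1))"] conjI allI impI)
    fix y assume y: "norm (y - x) < min d (e / (K + 1))"
    have "K * \<bar>y - x\<bar> \<le> (K + 1) * \<bar>y - x\<bar>" by (simp add: mult_right_mono)
    also have "\<dots> \<le> e" using y K by (simp add: field_simps)
    finally have "K * \<bar>y - x\<bar> * \<bar>y - x\<bar> \<le> e * \<bar>y - x\<bar>" by (simp add: mult_right_mono)
    then show "norm (F y - F x - (y - x) *\<^sub>R D) \<le> e * norm (y - x)"
      using F[of y] y by (simp add: power2_eq_square abs_mult_self_eq mult.assoc)
  qed (use d e K in auto)
qed

text \<open>To be used with f(t) = S(t)x and \<open>C = M * norm x\<close>. Since
  \<open>0 powr \<alpha>\<close> is 0, the bound at t = 0 forces \<open>f 0 = 0\<close>.\<close>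

locale laplace_growth =
  fixes f :: "real \<Rightarrow> 'a::banach" and C \<alpha> \<omega> :: real
  assumes cont: "continuous_on {0..} f" and alpha: "\<alpha> > 0" and C: "C \<ge> 0" and omega: "\<omega> \<ge> 0"
    and growth: "\<And>t. t \<ge> 0 \<Longrightarrow> norm (f t) \<le> C * t powr \<alpha> * exp (\<omega> * t)"
begin

text \<open>Up to the sign \<open>(-1) ^ m\<close>, the m-th derivative of the Laplace transform of
  \<open>f\<close>.\<close>

definition L :: "nat \<Rightarrow> real \<Rightarrow> 'a" where
  "L m l = integral {0..} (\<lambda>t. (t ^ m * exp (- l * t)) *\<^sub>R f t)"

lemma growth_power:
  assumes t: "t \<ge> 0"
  shows "norm ((t ^ m * exp (- l * t)) *\<^sub>R f t) \<le> C * (t powr (real m + \<alpha>) * exp (- (l - \<omega>) * t))"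
proof -
  have p: "t ^ m * t powr \<alpha> = t powr (real m + \<alpha>)"
    using t alpha by (cases "t = 0") (auto simp: powr_add powr_realpow)
  have "norm ((t ^ m * exp (- l * t)) *\<^sub>R f t) \<le> t ^ m * exp (- l * t) * (C * t powr \<alpha> * exp (\<omega> * t))"
    using t growth[OF t] by (simp add: mult_left_mono abs_mult)
  also have "\<dots> = C * ((t ^ m * t powr \<alpha>) * (exp (- l * t) * exp (\<omega> * t)))"
    by (simp add: algebra_simps)
  also have "exp (- l * t) * exp (\<omega> * t) = exp (- (l - \<omega>) * t)"
    by (simp add: algebra_simps flip: exp_add)
  finally show ?thesis by (simp add: p)
qed

lemma integrable_growth_power:
  assumes l: "l > \<omega>"
  shows "integrable lborel (\<lambda>t. indicator {0..} t * (C * (t powr (real m + \<alpha>) * exp (- (l - \<omega>) * t))))"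
proof -
  have "integrable lborel (\<lambda>t. C * (indicator {0..} t * (t powr (real m + \<alpha>) * exp (- (l - \<omega>) * t))))"
    using has_bochner_integral_Gamma_kernel[of "l - \<omega>" "real m + \<alpha>"] l alpha
    by (intro integrable_mult_right) (auto simp: has_bochner_integral_iff)
  then show ?thesis by (simp add: algebra_simps)
qed

lemma continuous_integrand: "continuous_on {0..} (\<lambda>t. (t ^ m * exp (- l * t)) *\<^sub>R f t)"
  by (intro continuous_intros cont)

lemma integrable_L:
  assumes "l > \<omega>"
  shows "(\<lambda>t. (t ^ m * exp (- l * t)) *\<^sub>R f t) integrable_on {0..}"
  by (rule Bochner_has_integral_half_line(1)[OF continuous_integrand integrable_growth_power[OF assms] growth_power])

lemma Bochner_L:
  assumes "l > \<omega>"
  shows "Bochner_has_integral lborel (\<lambda>t. indicator {0..} t *\<^sub>R (t ^ m * exp (- l * t)) *\<^sub>R f t) (L m l)"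
  unfolding L_def
  by (rule Bochner_has_integral_half_line(2)[OF continuous_integrand integrable_growth_power[OF assms] growth_power])

lemma norm_integral_Gamma_kernel_le:
  assumes g: "g integrable_on {0..}" and a: "a > 0" and s: "s > -1"
    and le: "\<And>t. t \<ge> 0 \<Longrightarrow> norm (g t) \<le> K * (t powr s * exp (- a * t))"
  shows "norm (integral {0..} g :: 'a) \<le> K * (Gamma (s + 1) / a powr (s + 1))"
proof -
  have h: "((\<lambda>t. K * (t powr s * exp (- a * t))) has_integral K * (Gamma (s + 1) / a powr (s + 1))) {0..}"
    by (intro has_integral_mult_right has_integral_Gamma_kernel a s)
  have "norm (integral {0..} g) \<le> integral {0..} (\<lambda>t. K * (t powr s * exp (- a * t)))"
    using g h le by (intro integral_norm_bound_integral) (auto simp: has_integral_iff)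
  then show ?thesis
    using h by (simp add: has_integral_iff)
qed

lemma norm_L_le:
  assumes l: "l > \<omega>"
  shows "norm (L m l) \<le> C * (Gamma (real m + \<alpha> + 1) / (l - \<omega>) powr (real m + \<alpha> + 1))"
  unfolding L_def
  by (rule norm_integral_Gamma_kernel_le) (use l alpha integrable_L[OF l] growth_power in auto)

text \<open>The remainder has the integrand of \<open>L m l\<close> multiplied by
  \<open>exp z - 1 - z\<close> with \<open>z = - ((y - l) * t)\<close>. Bounding this by
  \<open>exp \<bar>z\<bar> * z\<^sup>2\<close> costs two powers of t and a little exponential decay,
  so the remainder is controlled by a Gamma integral.\<close>

lemma L_has_vector_derivative:
  assumes l: "l > \<omega>"
  shows "(L m has_vector_derivative - L (Suc m) l) (at l)"
proof -
  \<comment> \<open>Half the distance from \<open>l\<close> to \<omega>: the loss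
    \<open>exp (c * t)\<close> still leaves the decay rate
    \<open>l - c - \<omega> = c > 0\<close>.\<close>
  define c where "c = (l - \<omega>) / 2"
  have c: "c > 0" and lc: "l - c > \<omega>" using l by (auto simp: c_def field_simps)
  define K where "K = C * (Gamma (real (m + 2) + \<alpha> + 1) / (l - c - \<omega>) powr (real (m + 2) + \<alpha> + 1))"
  show ?thesis
  proof (rule has_vector_derivative_quadratic[OF c])
    show "K \<ge> 0" unfolding K_def using C alpha by (intro mult_nonneg_nonneg divide_nonneg_nonneg) auto
    fix y assume y: "\<bar>y - l\<bar> < c"
    then have yo: "y > \<omega>" using lc by auto
    define g where "g t = (t ^ m * exp (- y * t)) *\<^sub>R f t - (t ^ m * exp (- l * t)) *\<^sub>R f t
      + (y - l) *\<^sub>R ((t ^ Suc m * exp (- l * t)) *\<^sub>R f t)" for t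
    have "(g has_integral L m y - L m l + (y - l) *\<^sub>R L (Suc m) l) {0..}"
      unfolding g_def L_def
      by (intro has_integral_add has_integral_diff has_integral_cmul integrable_integral integrable_L yo l)
    then have gi: "g integrable_on {0..}" and gI: "integral {0..} g = L m y - L m l - (y - l) *\<^sub>R - L (Suc m) l"
      by (auto simp: has_integral_iff)
    have "norm (integral {0..} g) \<le> ((y - l)\<^sup>2 * C) * (Gamma (real (m + 2) + \<alpha> + 1) / (l - c - \<omega>) powr (real (m + 2) + \<alpha> + 1))"
    proof (rule norm_integral_Gamma_kernel_le[OF gi])
      fix t :: real assume t: "t \<ge> 0"
      define z where "z = - ((y - l) * t)"
      have ez: "exp (- y * t) = exp (- l * t) * exp z"
        by (simp add: z_def algebra_simps flip: exp_add)
      have g_eq: "g t = (t ^ m * exp (- l * t) * (exp z - 1 - z)) *\<^sub>R f t"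
        unfolding g_def ez by (simp add: z_def algebra_simps)
      have "\<bar>exp z - 1 - z\<bar> \<le> exp \<bar>z\<bar> * z\<^sup>2"
        using Taylor_exp_field[of z 1] by (simp add: power2_eq_square algebra_simps)
      also have "\<dots> \<le> exp (c * t) * z\<^sup>2"
        using y t by (intro mult_right_mono) (auto simp: z_def abs_mult intro!: mult_right_mono)
      finally have "norm (g t) \<le> t ^ m * exp (- l * t) * (exp (c * t) * z\<^sup>2) * norm (f t)"
        unfolding g_eq using t by (auto simp: abs_mult intro!: mult_right_mono mult_left_mono)
      also have "\<dots> = (y - l)\<^sup>2 * norm ((t ^ (m + 2) * exp (- (l - c) * t)) *\<^sub>R f t)"
        using t by (simp add: z_def power2_eq_square algebra_simps flip: exp_add)
      also have "\<dots> \<le> (y - l)\<^sup>2 * (C * (t powr (real (m + 2) + \<alpha>) * exp (- (l - c - \<omega>) * t)))"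
        by (intro mult_left_mono growth_power t) auto
      finally show "norm (g t) \<le> ((y - l)\<^sup>2 * C) * (t powr (real (m + 2) + \<alpha>) * exp (- (l - c - \<omega>) * t))"
        by (simp add: mult.assoc)
    qed (use lc alpha in auto)
    then show "norm (L m y - L m l - (y - l) *\<^sub>R - L (Suc m) l) \<le> K * (y - l)\<^sup>2"
      unfolding gI K_def by (simp add: algebra_simps)
  qed
qed

end

section \<open>Resolvents of multivalued operators and derivatives of pseudo-resolvents\<close>

lemma is_resolvent_at_resolvent:
  assumes "l \<in> resolvent_set A"
  shows "is_resolvent_at l A (resolvent l A)"
proof -
  obtain T where T: "is_resolvent_at l A T"
    using assms by (auto simp: resolvent_set_def)
  have "U = T" if "is_resolvent_at l A U" for U
  proof (rule blinfun_eqI)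
    fix z
    have "(z, blinfun_apply U z) \<in> {(z, blinfun_apply T z) | z. True}"
      using T that unfolding is_resolvent_at_def by blast
    then show "blinfun_apply U z = blinfun_apply T z" by blast
  qed
  then show ?thesis
    unfolding resolvent_def using T by (blast intro: theI)
qed

text \<open>One pair of \<open>A\<close> is read in two ways: as the pair behind \<open>U z\<close>
  at \<open>m\<close>, and as a pair at \<open>l\<close>, where its argument is \<open>z\<close>
  shifted by \<open>(l - m)\<close> times \<open>U z\<close>.\<close>

lemma resolvent_equation:
  assumes T: "is_resolvent_at l A T" and U: "is_resolvent_at m A U"
  shows "U - T = (l - m) *\<^sub>R (T o\<^sub>L U)"
proof (rule blinfun_eqI)
  fix z
  have "(z, blinfun_apply U z) \<in> resolvent_graph m A"
    using U unfolding is_resolvent_at_def by blast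
  then obtain y where y: "(blinfun_apply U z, y) \<in> A" "z = m *\<^sub>R blinfun_apply U z - y"
    unfolding resolvent_graph_def by auto
  have "(l *\<^sub>R blinfun_apply U z - y, blinfun_apply U z) \<in> resolvent_graph l A"
    using y(1) unfolding resolvent_graph_def by (force simp: image_iff)
  then have "blinfun_apply U z = blinfun_apply T (l *\<^sub>R blinfun_apply U z - y)"
    using T unfolding is_resolvent_at_def by auto
  also have "l *\<^sub>R blinfun_apply U z - y = (l - m) *\<^sub>R blinfun_apply U z + z"
    by (subst (3) y(2)) (simp add: algebra_simps)
  finally have "blinfun_apply U z = (l - m) *\<^sub>R blinfun_apply T (blinfun_apply U z) + blinfun_apply T z"
    by (simp add: blinfun.bilinear_simps)
  then show "blinfun_apply (U - T) z = blinfun_apply ((l - m) *\<^sub>R (T o\<^sub>L U)) z"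
    by (simp add: blinfun.bilinear_simps diff_eq_eq)
qed

text \<open>Continuity in the parameter is drawn from the resolvent equation itself. Near
  \<open>l\<close> it bounds \<open>T m\<close> by twice the norm of \<open>T l\<close>; applying it
  once more inside the remainder produces the second factor \<open>l - m\<close>.\<close>

lemma pseudo_resolvent_has_vector_derivative:
  fixes T :: "real \<Rightarrow> 'a::real_normed_vector \<Rightarrow>\<^sub>L 'a"
  assumes eq: "\<And>l m. l > w \<Longrightarrow> m > w \<Longrightarrow> T m - T l = (l - m) *\<^sub>R (T l o\<^sub>L T m)" and l: "l > w"
  shows "(T has_vector_derivative - (T l o\<^sub>L T l)) (at l)"
proof (rule has_vector_derivative_quadratic)
  \<comment> \<open>The first bound keeps \<open>m\<close> above \<open>w\<close>. The second gives
    \<open>\<bar>l - m\<bar> * norm (T l) \<le> 1 / 2\<close>, so that the term with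
    \<open>norm (T m)\<close> can be absorbed; adding 1 avoids a zero denominator.\<close>
  define d where "d = min (l - w) (1 / (2 * norm (T l) + 1))"
  show "d > 0" using l by (auto simp: d_def add_nonneg_pos)
  show "0 \<le> 2 * norm (T l) ^ 3" by simp
  fix m assume m: "\<bar>m - l\<bar> < d"
  then have mw: "m > w" by (auto simp: d_def)
  have small: "\<bar>l - m\<bar> * norm (T l) \<le> 1 / 2"
  proof -
    have "\<bar>l - m\<bar> * (2 * norm (T l) + 1) \<le> 1"
      using m pos_less_divide_eq[of "2 * norm (T l) + 1" "\<bar>m - l\<bar>" 1]
      by (simp add: d_def add_nonneg_pos abs_minus_commute)
    then show ?thesis by (simp add: algebra_simps)
  qed
  have "norm (T m) \<le> norm (T l) + norm (T m - T l)"
    using norm_triangle_ineq[of "T l" "T m - T l"] by simp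
  also have "norm (T m - T l) \<le> \<bar>l - m\<bar> * (norm (T l) * norm (T m))"
    unfolding eq[OF l mw] by (simp add: mult_left_mono norm_blinfun_compose)
  also have "\<dots> \<le> 1 / 2 * norm (T m)"
    using mult_right_mono[OF small norm_ge_zero[of "T m"]] by (simp add: mult.assoc)
  finally have Tm: "norm (T m) \<le> 2 * norm (T l)" by simp
  have "T m - T l - (m - l) *\<^sub>R - (T l o\<^sub>L T l) = (l - m) *\<^sub>R (T l o\<^sub>L (T m - T l))"
    by (subst eq[OF l mw], rule blinfun_eqI) (simp add: blinfun.bilinear_simps algebra_simps)
  also have "norm \<dots> \<le> \<bar>l - m\<bar> * (norm (T l) * norm (T m - T l))"
    by (simp add: mult_left_mono norm_blinfun_compose)
  also have "\<dots> \<le> \<bar>l - m\<bar> * (norm (T l) * (\<bar>l - m\<bar> * (norm (T l) * (2 * norm (T l)))))"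
  proof (intro mult_left_mono)
    have "norm (T m - T l) \<le> \<bar>l - m\<bar> * (norm (T l) * norm (T m))"
      unfolding eq[OF l mw] by (simp add: mult_left_mono norm_blinfun_compose)
    also have "\<dots> \<le> \<bar>l - m\<bar> * (norm (T l) * (2 * norm (T l)))"
      by (intro mult_left_mono Tm) auto
    finally show "norm (T m - T l) \<le> \<bar>l - m\<bar> * (norm (T l) * (2 * norm (T l)))" .
  qed auto
  also have "\<dots> = 2 * norm (T l) ^ 3 * (\<bar>m - l\<bar> * \<bar>m - l\<bar>)"
    by (simp add: power3_eq_cube abs_minus_commute algebra_simps)
  also have "\<bar>m - l\<bar> * \<bar>m - l\<bar> = (m - l)\<^sup>2"
    by (simp add: power2_eq_square abs_mult_self_eq)
  finally show "norm (T m - T l - (m - l) *\<^sub>R - (T l o\<^sub>L T l)) \<le> 2 * norm (T l) ^ 3 * (m - l)\<^sup>2" .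
qed

lemma pseudo_resolvent_power_has_vector_derivative:
  fixes T :: "real \<Rightarrow> 'a::real_normed_vector \<Rightarrow>\<^sub>L 'a"
  assumes eq: "\<And>l m. l > w \<Longrightarrow> m > w \<Longrightarrow> T m - T l = (l - m) *\<^sub>R (T l o\<^sub>L T m)" and l: "l > w"
  shows "((\<lambda>l. (blinfun_apply (T l) ^^ n) x) has_vector_derivative
    - (real n *\<^sub>R (blinfun_apply (T l) ^^ Suc n) x)) (at l)"
proof (induction n)
  case 0
  show ?case by (simp add: has_vector_derivative_const)
next
  case (Suc n)
  have "((\<lambda>l. blinfun_apply (T l) ((blinfun_apply (T l) ^^ n) x)) has_vector_derivative
     (blinfun_apply (T l) (- (real n *\<^sub>R (blinfun_apply (T l) ^^ Suc n) x)) +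
      blinfun_apply (- (T l o\<^sub>L T l)) ((blinfun_apply (T l) ^^ n) x))) (at l)"
    by (rule bounded_bilinear.has_vector_derivative[OF bounded_bilinear_blinfun_apply
          pseudo_resolvent_has_vector_derivative[OF eq l] Suc])
  then show ?case
    by (simp add: blinfun.bilinear_simps algebra_simps)
qed

section \<open>Derivatives of the Laplace transform times a power of the parameter\<close>

context laplace_growth
begin

text \<open>\<open>P k m\<close> is \<open>(-1) ^ m\<close> times the \<open>m\<close>-th derivative of \<open>l ^ k *\<^sub>R L 0 l\<close>.  At \<open>m = 0\<close> the
  truncated index \<open>m - 1\<close> is harmless because its coefficient vanishes.\<close>

primrec P :: "nat \<Rightarrow> nat \<Rightarrow> real \<Rightarrow> 'a" where
  "P 0 m l = L m l"
| "P (Suc k) m l = l *\<^sub>R P k m l - real m *\<^sub>R P k (m - 1) l"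

lemma P_0_right: "P k 0 l = l ^ k *\<^sub>R L 0 l"
  by (induction k) auto

text \<open>Leibniz rule for one factor \<open>l\<close>: its own derivative contributes one copy of
  \<open>P k m\<close> and the second term of the recursion \<open>m\<close> copies, which together
  give the coefficient \<open>m + 1\<close> of \<open>P (Suc k) (Suc m)\<close>.\<close>

lemma P_has_vector_derivative:
  assumes l: "l > \<omega>"
  shows "(P k m has_vector_derivative - P k (Suc m) l) (at l)"
proof (induction k arbitrary: m)
  case 0
  have "P 0 m = L m" by auto
  then show ?case using L_has_vector_derivative[OF l] by simp
next
  case (Suc k)
  have "((\<lambda>l. l *\<^sub>R P k m l) has_vector_derivative (l *\<^sub>R - P k (Suc m) l + 1 *\<^sub>R P k m l)) (at l)"
    by (rule bounded_bilinear.has_vector_derivative[OF bounded_bilinear_scaleR has_vector_derivative_id Suc])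
  moreover have "((\<lambda>l. real m *\<^sub>R P k (m - 1) l) has_vector_derivative real m *\<^sub>R - P k m l) (at l)"
  proof (cases m)
    case (Suc r)
    then show ?thesis
      using bounded_linear.has_vector_derivative[OF bounded_linear_scaleR_right Suc.IH[of r]] by simp
  qed (simp add: has_vector_derivative_const)
  ultimately have "((\<lambda>l. l *\<^sub>R P k m l - real m *\<^sub>R P k (m - 1) l) has_vector_derivative
      (l *\<^sub>R - P k (Suc m) l + 1 *\<^sub>R P k m l) - real m *\<^sub>R - P k m l) (at l)"
    by (rule has_vector_derivative_diff)
  moreover have "P (Suc k) m = (\<lambda>l. l *\<^sub>R P k m l - real m *\<^sub>R P k (m - 1) l)"
    by auto
  ultimately show ?case
    by (simp add: algebra_simps)
qed

text \<open>Both sides agree for m = 0. If they agree for \<open>m\<close> on the open half-line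
  beyond \<open>w\<close>, their derivatives agree there too, and these are the two sides for
  \<open>Suc m\<close> up to sign.\<close>

lemma P_eq_resolvent_power:
  fixes T :: "real \<Rightarrow> 'a \<Rightarrow>\<^sub>L 'a"
  assumes eq: "\<And>l m. l > w \<Longrightarrow> m > w \<Longrightarrow> T m - T l = (l - m) *\<^sub>R (T l o\<^sub>L T m)"
    and w: "w \<ge> \<omega>" and T: "\<And>l. l > w \<Longrightarrow> blinfun_apply (T l) x = l ^ k *\<^sub>R L 0 l" and l: "l > w"
  shows "P k m l = fact m *\<^sub>R (blinfun_apply (T l) ^^ Suc m) x"
  using l
proof (induction m arbitrary: l)
  case 0
  then show ?case by (simp add: P_0_right T)
next
  case (Suc m)
  have "((\<lambda>l. fact m *\<^sub>R (blinfun_apply (T l) ^^ Suc m) x) has_vector_derivative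
      fact m *\<^sub>R - (real (Suc m) *\<^sub>R (blinfun_apply (T l) ^^ Suc (Suc m)) x)) (at l)"
    by (rule bounded_linear.has_vector_derivative[OF bounded_linear_scaleR_right
          pseudo_resolvent_power_has_vector_derivative[OF eq Suc.prems]])
  then have "(P k m has_vector_derivative
      fact m *\<^sub>R - (real (Suc m) *\<^sub>R (blinfun_apply (T l) ^^ Suc (Suc m)) x)) (at l)"
    by (rule has_vector_derivative_transform_within_open[of _ _ _ "{w<..}"]) (use Suc in auto)
  moreover have "(P k m has_vector_derivative - P k (Suc m) l) (at l)"
    using Suc.prems w by (intro P_has_vector_derivative) auto
  ultimately have "- P k (Suc m) l = fact m *\<^sub>R - (real (Suc m) *\<^sub>R (blinfun_apply (T l) ^^ Suc (Suc m)) x)"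
    by (rule vector_derivative_unique_at[rotated])
  then show ?case
    by (simp add: algebra_simps del: funpow.simps)
qed

text \<open>For \<open>l \<ge> 2 * \<omega>\<close> the difference \<open>l - \<omega>\<close> is at
  least \<open>l / 2\<close>, so the Gamma bound becomes a pure power of \<open>l\<close>. A factor
  \<open>l\<close> and a lowering of \<open>m\<close> both raise the exponent by one, hence both
  terms of the recursion have the same order.\<close>

lemma norm_P_le:
  "\<exists>K\<ge>0. \<forall>l. l > 0 \<longrightarrow> l \<ge> 2 * \<omega> \<longrightarrow> norm (P k m l) \<le> K * l powr (real k - real m - \<alpha> - 1)"
proof (induction k arbitrary: m)
  case 0
  define e where "e = real m + \<alpha> + 1"
  have e: "e > 0" using alpha by (simp add: e_def)
  show ?case
  proof (intro exI[of _ "C * Gamma e * 2 powr e"] conjI allI impI)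
    show "0 \<le> C * Gamma e * 2 powr e"
      using C e by (intro mult_nonneg_nonneg) (auto intro: less_imp_le Gamma_real_pos)
    fix l :: real assume l: "l > 0" "l \<ge> 2 * \<omega>"
    then have lo: "l > \<omega>" using omega by auto
    have "norm (L m l) \<le> C * (Gamma e / (l - \<omega>) powr e)"
      using norm_L_le[OF lo] by (simp add: e_def)
    also have "\<dots> \<le> C * (Gamma e / (l / 2) powr e)"
      using C e l by (intro mult_left_mono divide_left_mono powr_mono2 mult_pos_pos)
        (auto intro: less_imp_le Gamma_real_pos)
    also have "\<dots> = C * Gamma e * 2 powr e * l powr (- e)"
      using l by (simp add: powr_divide powr_minus field_simps)
    also have "- e = real 0 - real m - \<alpha> - 1"
      by (simp add: e_def)
    finally show "norm (P 0 m l) \<le> C * Gamma e * 2 powr e * l powr (real 0 - real m - \<alpha> - 1)"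
      by simp
  qed
next
  case (Suc k)
  obtain K1 where K1: "K1 \<ge> 0" "\<And>l. l > 0 \<Longrightarrow> l \<ge> 2 * \<omega> \<Longrightarrow>
      norm (P k m l) \<le> K1 * l powr (real k - real m - \<alpha> - 1)"
    using Suc[of m] by auto
  obtain K2 where K2: "K2 \<ge> 0" "\<And>l. l > 0 \<Longrightarrow> l \<ge> 2 * \<omega> \<Longrightarrow>
      norm (P k (m - 1) l) \<le> K2 * l powr (real k - real (m - 1) - \<alpha> - 1)"
    using Suc[of "m - 1"] by auto
  show ?case
  proof (intro exI[of _ "K1 + real m * K2"] conjI allI impI)
    fix l :: real assume l: "l > 0" "l \<ge> 2 * \<omega>"
    let ?p = "l powr (real (Suc k) - real m - \<alpha> - 1)"
    have "norm (P (Suc k) m l) \<le> norm (l *\<^sub>R P k m l) + norm (real m *\<^sub>R P k (m - 1) l)"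
      by (simp only: P.simps norm_triangle_ineq4)
    also have "norm (l *\<^sub>R P k m l) \<le> l * (K1 * l powr (real k - real m - \<alpha> - 1))"
      using K1(2)[OF l] l by simp
    also have "\<dots> = K1 * (l * l powr (real k - real m - \<alpha> - 1))"
      by simp
    also have "l * l powr (real k - real m - \<alpha> - 1) = l powr (1 + (real k - real m - \<alpha> - 1))"
      using l by (simp add: powr_mult_base)
    also have "1 + (real k - real m - \<alpha> - 1) = real (Suc k) - real m - \<alpha> - 1"
      by simp
    also have "norm (real m *\<^sub>R P k (m - 1) l) \<le> real m * K2 * ?p"
    proof (cases m)
      case (Suc r)
      then have "real k - real (m - 1) - \<alpha> - 1 = real (Suc k) - real m - \<alpha> - 1" by simp
      moreover have "norm (real m *\<^sub>R P k (m - 1) l) = real m * norm (P k (m - 1) l)" by simp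
      ultimately show ?thesis
        using mult_left_mono[OF K2(2)[OF l], of "real m"] by (simp only: mult.assoc)
    qed simp
    finally show "norm (P (Suc k) m l) \<le> (K1 + real m * K2) * ?p"
      by (simp add: algebra_simps)
  qed (use K1 K2 in auto)
qed

end

section \<open>The substitution \<open>l = N / t\<close> and Taylor's formula in t\<close>

context laplace_growth
begin

text \<open>\<open>F(t/n)\<^sup>n x\<close> is \<open>n\<^sup>n / (n - 1)!\<close> times \<open>V n k (n - 1) t\<close>, whose \<open>k\<close>-fold antiderivative is
  \<open>V n 0 (n - 1 - k)\<close>, since differentiation in \<open>t\<close> raises both indices by one.\<close>

definition V :: "real \<Rightarrow> nat \<Rightarrow> nat \<Rightarrow> real \<Rightarrow> 'a" where
  "V N k m t = inverse t ^ Suc m *\<^sub>R P k m (N / t)"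

text \<open>The chain rule yields \<open>N / t\<close> times \<open>P k (Suc m)\<close>, the
  prefactor yields \<open>- (m + 1)\<close> times \<open>P k m\<close>; after extracting
  \<open>inverse t ^ (m + 2)\<close> this is the recursion of \<open>P\<close>.\<close>

lemma V_has_vector_derivative:
  assumes t: "t > 0" and N: "N / t > \<omega>"
  shows "(V N k m has_vector_derivative V N (Suc k) (Suc m) t) (at t)"
proof -
  have d1: "((\<lambda>t. N / t) has_vector_derivative (- (N / t\<^sup>2))) (at t)"
    unfolding has_real_derivative_iff_has_vector_derivative[symmetric]
    using t by (auto intro!: derivative_eq_intros simp: power2_eq_square field_simps)
  have d2: "((\<lambda>t. P k m (N / t)) has_vector_derivative (- (N / t\<^sup>2)) *\<^sub>R - P k (Suc m) (N / t)) (at t)"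
    using vector_diff_chain_at[OF d1 P_has_vector_derivative[OF N]] by (simp add: o_def)
  have d3: "((\<lambda>t. inverse t ^ Suc m) has_vector_derivative - (real (Suc m) * inverse t ^ Suc (Suc m))) (at t)"
    unfolding has_real_derivative_iff_has_vector_derivative[symmetric]
    using DERIV_power_Suc[OF DERIV_inverse[of t UNIV], of m] t by (simp add: algebra_simps)
  have "((\<lambda>t. inverse t ^ Suc m *\<^sub>R P k m (N / t)) has_vector_derivative
     (inverse t ^ Suc m *\<^sub>R ((- (N / t\<^sup>2)) *\<^sub>R - P k (Suc m) (N / t)) +
      - (real (Suc m) * inverse t ^ Suc (Suc m)) *\<^sub>R P k m (N / t))) (at t)"
    by (rule bounded_bilinear.has_vector_derivative[OF bounded_bilinear_scaleR d3 d2])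
  moreover have "inverse t ^ Suc m *\<^sub>R ((- (N / t\<^sup>2)) *\<^sub>R - P k (Suc m) (N / t)) +
      - (real (Suc m) * inverse t ^ Suc (Suc m)) *\<^sub>R P k m (N / t) = V N (Suc k) (Suc m) t"
  proof -
    have "inverse t ^ Suc m * (N / t\<^sup>2) = inverse t ^ Suc (Suc m) * (N / t)"
      using t by (simp add: power2_eq_square field_simps)
    then show ?thesis
      unfolding V_def P.simps by (simp add: scaleR_diff_right del: power_Suc)
  qed
  ultimately show ?thesis
    unfolding V_def[abs_def] by (simp del: P.simps)
qed

text \<open>The index \<open>m\<close> cancels between the prefactor and the power of
  \<open>N / t\<close>, so each differentiation of \<open>V\<close> in t costs exactly one power of
  t near 0.\<close>

lemma norm_V_le:
  assumes N: "N > 0"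
  shows "\<exists>K\<ge>0. \<forall>t. t > 0 \<longrightarrow> N / t \<ge> 2 * \<omega> \<longrightarrow> norm (V N k m t) \<le> K * t powr (\<alpha> - real k)"
proof -
  define e where "e = real k - real m - \<alpha> - 1"
  obtain K where K: "K \<ge> 0" "\<And>l. l > 0 \<Longrightarrow> l \<ge> 2 * \<omega> \<Longrightarrow> norm (P k m l) \<le> K * l powr e"
    using norm_P_le[of k m] by (auto simp: e_def)
  show ?thesis
  proof (intro exI[of _ "K * N powr e"] conjI allI impI)
    fix t assume t: "t > 0" "N / t \<ge> 2 * \<omega>"
    have "norm (V N k m t) \<le> inverse t ^ Suc m * (K * (N / t) powr e)"
      unfolding V_def using t N K(2)[of "N / t"] by (simp add: mult_left_mono del: power_Suc)
    also have "inverse t ^ Suc m = t powr (- real (Suc m))"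
      using t by (simp add: powr_minus powr_realpow power_inverse del: power_Suc of_nat_Suc)
    also have "(N / t) powr e = N powr e * t powr (- e)"
      using t N by (simp add: powr_divide powr_minus_divide)
    also have "t powr (- real (Suc m)) * (K * (N powr e * t powr (- e)))
        = K * N powr e * (t powr (- real (Suc m)) * t powr (- e))"
      by simp
    also have "t powr (- real (Suc m)) * t powr (- e) = t powr (\<alpha> - real k)"
      by (simp add: e_def flip: powr_add)
    finally show "norm (V N k m t) \<le> K * N powr e * t powr (\<alpha> - real k)" .
  qed (use K in auto)
qed

lemma omega_less_quotient:
  assumes N: "N > 0" and Nt0: "N / t0 \<ge> 2 * \<omega>" and t: "0 < t" "t \<le> t0"
  shows "N / t \<ge> 2 * \<omega>" and "N / t > \<omega>"
proof -
  have "N / t0 \<le> N / t" using t N by (intro divide_left_mono) auto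
  with Nt0 show "N / t \<ge> 2 * \<omega>" by simp
  moreover have "N / t > 0" using t N by simp
  ultimately show "N / t > \<omega>" using omega by linarith
qed

lemma Bochner_V:
  assumes N: "N > 0" and t0: "t0 > 0" and Nt0: "N / t0 \<ge> 2 * \<omega>" and k: "\<alpha> > real k - 1"
    and c: "continuous_on {0..t0} c" and B: "\<And>t. 0 \<le> t \<Longrightarrow> t \<le> t0 \<Longrightarrow> \<bar>c t\<bar> \<le> B"
  obtains I where
    "Bochner_has_integral lborel (\<lambda>t. indicator {0<..<t0} t *\<^sub>R c t *\<^sub>R V N k m t) I"
    "(\<lambda>n. integral {t0 / (real n + 2)..t0} (\<lambda>t. c t *\<^sub>R V N k m t)) \<longlonglongrightarrow> I"
proof -
  obtain K where K: "K \<ge> 0" "\<And>t. t > 0 \<Longrightarrow> N / t \<ge> 2 * \<omega> \<Longrightarrow> norm (V N k m t) \<le> K * t powr (\<alpha> - real k)"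
    using norm_V_le[OF N, of k m] by auto
  note N_ge = omega_less_quotient[OF N Nt0]
  have B0: "B \<ge> 0" using B[of 0] t0 by auto
  \<comment> \<open>The factor \<open>exp (t0 - t)\<close>, at least 1 on the interval, turns the
    power bound into a Gamma kernel, integrable because \<open>\<alpha> - k > -1\<close>.\<close>
  define h where "h t = B * K * exp t0 * (t powr (\<alpha> - real k) * exp (- 1 * t))" for t
  show ?thesis
  proof (rule Bochner_has_integral_improper[of "\<lambda>n. t0 / (real n + 2)" "\<lambda>_. t0"
        "\<lambda>t. c t *\<^sub>R V N k m t" "{0<..<t0}" h])
    fix n
    have pos: "t0 / (real n + 2) > 0" using t0 by (simp add: add_nonneg_pos)
    show "t0 / (real n + 2) \<le> t0" using t0 by (simp add: field_simps)
    show "continuous_on {t0 / (real n + 2)..t0} (\<lambda>t. c t *\<^sub>R V N k m t)"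
    proof (intro continuous_intros)
      show "continuous_on {t0 / (real n + 2)..t0} c"
        by (rule continuous_on_subset[OF c]) (use pos in auto)
      show "continuous_on {t0 / (real n + 2)..t0} (V N k m)"
        using pos by (intro continuous_at_imp_continuous_on ballI
            has_vector_derivative_continuous[OF V_has_vector_derivative] N_ge) auto
    qed
    show "{t0 / (real n + 2)..<t0} \<subseteq> {0<..<t0}" using pos by auto
  next
    fix t assume t: "t \<in> {0<..<t0}"
    have "(\<lambda>n. t0 / (real n + 2)) \<longlonglongrightarrow> 0" by real_asymp
    then have "\<forall>\<^sub>F n in sequentially. t0 / (real n + 2) < t"
      using t by (intro order_tendstoD) auto
    then show "\<forall>\<^sub>F n in sequentially. t \<in> {t0 / (real n + 2)..<t0}"
      by eventually_elim (use t in auto)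
    have "norm (c t *\<^sub>R V N k m t) \<le> B * (K * t powr (\<alpha> - real k))"
      using t B[of t] K(2)[of t] N_ge[of t] B0 by (auto intro!: mult_mono)
    also have "\<dots> \<le> B * (K * t powr (\<alpha> - real k)) * exp (t0 - t)"
      using t B0 K(1) by (intro mult_right_mono[of 1, simplified] mult_nonneg_nonneg
          order_trans[OF _ mult_left_mono[of 1 "exp (t0 - t)"]]) auto
    also have "\<dots> = h t"
      by (simp add: h_def exp_diff exp_minus divide_simps)
    finally show "norm (c t *\<^sub>R V N k m t) \<le> h t" .
  next
    have "integrable lborel (\<lambda>t. indicator {0<..<t0} t *\<^sub>R
        (B * K * exp t0 * (indicator {0..} t * (t powr (\<alpha> - real k) * exp (- 1 * t)))))"
      using has_bochner_integral_Gamma_kernel[of 1 "\<alpha> - real k"] k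
      by (intro integrable_mult_indicator integrable_mult_right) (auto simp: has_bochner_integral_iff)
    also have "(\<lambda>t. indicator {0<..<t0} t *\<^sub>R
        (B * K * exp t0 * (indicator {0..} t * (t powr (\<alpha> - real k) * exp (- 1 * t)))))
        = (\<lambda>t. indicator {0<..<t0} t * h t)"
      by (auto simp: h_def indicator_def)
    finally show "integrable lborel (\<lambda>t. indicator {0<..<t0} t * h t)" .
  qed (rule that)
qed

text \<open>Taylor's formula of order \<open>k\<close> between a small left endpoint and
  \<open>t0\<close> has the wanted integral as its remainder. The boundary terms at the left
  endpoint vanish as it tends to 0, and the integrals tend to the Bochner integral.\<close>

lemma Bochner_Taylor_V:
  assumes N: "N > 0" and t0: "t0 > 0" and Nt0: "N / t0 \<ge> 2 * \<omega>" and k: "\<alpha> > real k - 1" "k \<ge> 1"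
  shows "Bochner_has_integral lborel
    (\<lambda>t. indicator {0<..<t0} t *\<^sub>R ((t0 - t) ^ (k - 1) / fact (k - 1)) *\<^sub>R r *\<^sub>R V N k (q + k) t)
    (r *\<^sub>R V N 0 q t0)"
proof -
  let ?c = "\<lambda>t. (t0 - t) ^ (k - 1) / fact (k - 1)"
  let ?a = "\<lambda>n. t0 / (real n + 2)"
  obtain I where I: "Bochner_has_integral lborel (\<lambda>t. indicator {0<..<t0} t *\<^sub>R (?c t * r) *\<^sub>R V N k (q + k) t) I"
    "(\<lambda>n. integral {?a n..t0} (\<lambda>t. (?c t * r) *\<^sub>R V N k (q + k) t)) \<longlonglongrightarrow> I"
  proof (rule Bochner_V[OF N t0 Nt0 k(1), of "\<lambda>t. ?c t * r" "t0 ^ (k - 1) / fact (k - 1) * \<bar>r\<bar>" "q + k"])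
    show "continuous_on {0..t0} (\<lambda>t. ?c t * r)" by (intro continuous_intros) auto
    show "\<bar>?c t * r\<bar> \<le> t0 ^ (k - 1) / fact (k - 1) * \<bar>r\<bar>" if "0 \<le> t" "t \<le> t0" for t
      using that by (auto simp: abs_mult power_abs intro!: mult_right_mono divide_right_mono power_mono)
  qed
  have a: "?a n > 0" "?a n \<le> t0" for n
    using t0 by (auto simp: add_nonneg_pos field_simps)
  note N_ge = omega_less_quotient[OF N Nt0]
  have taylor: "integral {?a n..t0} (\<lambda>t. ?c t *\<^sub>R V N k (q + k) t)
      = V N 0 q t0 - (\<Sum>i<k. ((t0 - ?a n) ^ i / fact i) *\<^sub>R V N i (q + i) (?a n))" for n
  proof (rule integral_unique, rule Taylor_has_integral[where Df = "\<lambda>i. V N i (q + i)" and f = "V N 0 q"])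
    show "(V N i (q + i) has_vector_derivative V N (Suc i) (q + Suc i) t) (at t within {?a n..t0})"
      if "i < k" "?a n \<le> t" "t \<le> t0" for i t
      using V_has_vector_derivative[of t N i "q + i"] N_ge[of t] that a[of n]
      by (simp add: has_vector_derivative_at_within)
  qed (use k a in auto)
  have "(\<lambda>n. \<Sum>i<k. ((t0 - ?a n) ^ i / fact i) *\<^sub>R V N i (q + i) (?a n)) \<longlonglongrightarrow> (\<Sum>i<k. 0)"
  proof (intro tendsto_sum)
    fix i assume i: "i \<in> {..<k}"
    obtain K where K: "K \<ge> 0" "\<And>t. t > 0 \<Longrightarrow> N / t \<ge> 2 * \<omega> \<Longrightarrow>
        norm (V N i (q + i) t) \<le> K * t powr (\<alpha> - real i)"
      using norm_V_le[OF N, of i "q + i"] by auto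
    \<comment> \<open>For \<open>i \<le> k - 1\<close> the bound \<open>\<alpha> > k - 1\<close>
      leaves a positive power of the endpoint.\<close>
    have "\<alpha> - real i > 0" using i k by auto
    then have "(\<lambda>n. ?a n powr (\<alpha> - real i)) \<longlonglongrightarrow> 0"
      using t0 by real_asymp
    then have "(\<lambda>n. t0 ^ i / fact i * (K * ?a n powr (\<alpha> - real i))) \<longlonglongrightarrow> 0"
      by (intro tendsto_mult_right_zero)
    then show "(\<lambda>n. ((t0 - ?a n) ^ i / fact i) *\<^sub>R V N i (q + i) (?a n)) \<longlonglongrightarrow> 0"
    proof (rule Lim_null_comparison[rotated], intro always_eventually allI)
      fix n
      have "norm (((t0 - ?a n) ^ i / fact i) *\<^sub>R V N i (q + i) (?a n))
          = (t0 - ?a n) ^ i / fact i * norm (V N i (q + i) (?a n))"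
        using a[of n] by simp
      also have "\<dots> \<le> t0 ^ i / fact i * (K * ?a n powr (\<alpha> - real i))"
        using a[of n] N_ge[of "?a n"] K(2)[of "?a n"]
        by (intro mult_mono divide_right_mono power_mono) auto
      finally show "norm (((t0 - ?a n) ^ i / fact i) *\<^sub>R V N i (q + i) (?a n))
          \<le> t0 ^ i / fact i * (K * ?a n powr (\<alpha> - real i))" .
    qed
  qed
  from tendsto_diff[OF tendsto_const[of "V N 0 q t0"] this]
  have "(\<lambda>n. integral {?a n..t0} (\<lambda>t. ?c t *\<^sub>R V N k (q + k) t)) \<longlonglongrightarrow> V N 0 q t0"
    unfolding taylor by simp
  then have "(\<lambda>n. integral {?a n..t0} (\<lambda>t. r *\<^sub>R ?c t *\<^sub>R V N k (q + k) t)) \<longlonglongrightarrow> r *\<^sub>R V N 0 q t0"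
    unfolding integral_cmul by (intro tendsto_intros)
  then have "(\<lambda>n. integral {?a n..t0} (\<lambda>t. (?c t * r) *\<^sub>R V N k (q + k) t)) \<longlonglongrightarrow> r *\<^sub>R V N 0 q t0"
    by (simp only: scaleR_scaleR mult.commute)
  then have "I = r *\<^sub>R V N 0 q t0"
    using I(2) LIMSEQ_unique by blast
  with I(1) show ?thesis by simp
qed

end

section \<open>Moments of the kernel and the approximate identity\<close>

text \<open>With \<open>p > 0\<close> the two kinds of power agree also at s = 0, where
  \<open>0 powr 0\<close> is 0 but \<open>0 ^ 0\<close> is 1.\<close>

lemma has_integral_power_exp:
  fixes a :: real
  assumes a: "a > 0" and p: "p > 0"
  shows "((\<lambda>s. s ^ p * exp (- a * s)) has_integral fact p / a ^ Suc p) {0..}"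
proof -
  have "((\<lambda>s. s powr real p * exp (- a * s)) has_integral Gamma (real p + 1) / a powr (real p + 1)) {0..}"
    using a by (intro has_integral_Gamma_kernel) auto
  moreover have "Gamma (real p + 1) = fact p"
    using Gamma_fact[of p, where 'a = real] by (simp add: add.commute)
  moreover have "a powr (real p + 1) = a ^ Suc p"
    using a powr_realpow[of a "Suc p"] by (simp add: add.commute)
  ultimately have "((\<lambda>s. s powr real p * exp (- a * s)) has_integral fact p / a ^ Suc p) {0..}"
    by simp
  then show ?thesis
    by (rule has_integral_eq[rotated]) (use p in \<open>auto simp: powr_realpow'\<close>)
qed

lemma has_integral_quadratic_power_exp:
  fixes a t :: real
  assumes a: "a > 0" and q: "q > 0"
  shows "((\<lambda>s. s ^ q * (s - t)\<^sup>2 * exp (- a * s)) has_integral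
    fact q / a ^ Suc q * ((real q + 1) * (real q + 2) / a\<^sup>2 - 2 * t * (real q + 1) / a + t\<^sup>2)) {0..}"
proof -
  have "((\<lambda>s. s ^ (q + 2) * exp (- a * s) - 2 * t * (s ^ (q + 1) * exp (- a * s)) + t\<^sup>2 * (s ^ q * exp (- a * s)))
    has_integral fact (q + 2) / a ^ Suc (q + 2) - 2 * t * (fact (q + 1) / a ^ Suc (q + 1)) + t\<^sup>2 * (fact q / a ^ Suc q)) {0..}"
    by (intro has_integral_add has_integral_diff has_integral_mult_right has_integral_power_exp a) (use q in auto)
  moreover have "(\<lambda>s. s ^ (q + 2) * exp (- a * s) - 2 * t * (s ^ (q + 1) * exp (- a * s)) + t\<^sup>2 * (s ^ q * exp (- a * s)))
      = (\<lambda>s. s ^ q * (s - t)\<^sup>2 * exp (- a * s))"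
    by (auto simp: power2_eq_square algebra_simps)
  moreover have "fact (q + 2) / a ^ Suc (q + 2) - 2 * t * (fact (q + 1) / a ^ Suc (q + 1)) + t\<^sup>2 * (fact q / a ^ Suc q)
      = fact q / a ^ Suc q * ((real q + 1) * (real q + 2) / a\<^sup>2 - 2 * t * (real q + 1) / a + t\<^sup>2)"
  proof -
    have "fact (q + 2) = (real q + 2) * ((real q + 1) * fact q)" "fact (q + 1) = (real q + 1) * (fact q :: real)"
      by (auto simp: algebra_simps)
    then show ?thesis
      using a by (simp add: power2_eq_square field_simps)
  qed
  ultimately show ?thesis by simp
qed

text \<open>A product of \<open>k\<close> quotients, each tending to 1. It will be the total mass of
  the kernel.\<close>

lemma fact_ratio_tendsto:
  "(\<lambda>q. real (q + k + 1) ^ k * fact q / fact (q + k)) \<longlonglongrightarrow> 1"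
proof -
  have f: "fact (q + k) = fact q * (\<Prod>i<k. real (q + 1 + i))" for q
    by (induction k) (auto simp: algebra_simps)
  have "real (q + k + 1) ^ k * fact q / fact (q + k) = (\<Prod>i<k. real (q + k + 1) / real (q + 1 + i))" for q
    by (simp add: f prod_dividef)
  moreover have "(\<lambda>q. \<Prod>i<k. real (q + k + 1) / real (q + 1 + i)) \<longlonglongrightarrow> (\<Prod>i<k. 1)"
    by (intro tendsto_prod) real_asymp
  ultimately show ?thesis by simp
qed

context laplace_growth
begin

text \<open>Near \<open>t\<close> continuity gives \<open>e\<close>. Elsewhere
  \<open>(s - t)\<^sup>2 / d\<^sup>2\<close> is at least 1 and the growth bound applies, with
  \<open>s powr \<alpha>\<close> absorbed into the exponential. As in Chebyshev's inequality, second
  moments then suffice.\<close>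

lemma deviation_le:
  assumes t: "t > 0" and e: "e > 0"
  obtains K where "K \<ge> 0" "\<And>s. s \<ge> 0 \<Longrightarrow> norm (f s - f t) \<le> e + K * ((s - t)\<^sup>2 * exp ((\<alpha> + \<omega>) * s))"
proof -
  obtain d where d: "d > 0" "\<And>s. s \<ge> 0 \<Longrightarrow> \<bar>s - t\<bar> < d \<Longrightarrow> norm (f s - f t) < e"
    using cont[unfolded continuous_on_iff, rule_format, of t e] t e by (auto simp: dist_norm)
  define K where "K = (C + norm (f t)) / d\<^sup>2"
  have K0: "K \<ge> 0" using C by (simp add: K_def)
  show ?thesis
  proof (rule that[OF K0])
    fix s :: real assume s: "s \<ge> 0"
    show "norm (f s - f t) \<le> e + K * ((s - t)\<^sup>2 * exp ((\<alpha> + \<omega>) * s))"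
    proof (cases "\<bar>s - t\<bar> < d")
      case True
      have "0 \<le> K * ((s - t)\<^sup>2 * exp ((\<alpha> + \<omega>) * s))" using K0 by simp
      with d(2)[OF s True] show ?thesis by linarith
    next
      case False
      have "s powr \<alpha> \<le> exp s powr \<alpha>"
      proof (rule powr_mono2)
        show "s \<le> exp s" using exp_ge_add_one_self[of s] by linarith
      qed (use s alpha in auto)
      also have "\<dots> = exp (\<alpha> * s)" by (simp add: exp_powr_real mult.commute)
      finally have "norm (f s) \<le> C * exp (\<alpha> * s) * exp (\<omega> * s)"
        using C by (intro order_trans[OF growth[OF s]] mult_right_mono mult_left_mono) auto
      then have fs: "norm (f s) \<le> C * exp ((\<alpha> + \<omega>) * s)"
        by (simp add: algebra_simps exp_add)
      have "exp ((\<alpha> + \<omega>) * s) \<ge> 1" using alpha omega s by simp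
      then have "norm (f t) \<le> norm (f t) * exp ((\<alpha> + \<omega>) * s)"
        by (simp add: mult_le_cancel_left1)
      with fs have "norm (f s - f t) \<le> (C + norm (f t)) * exp ((\<alpha> + \<omega>) * s)"
        by (intro order_trans[OF norm_triangle_ineq4]) (simp add: algebra_simps)
      also have "\<dots> = K * (d\<^sup>2 * exp ((\<alpha> + \<omega>) * s))"
        using d by (simp add: K_def)
      also have "\<dots> \<le> K * ((s - t)\<^sup>2 * exp ((\<alpha> + \<omega>) * s))"
        using False d K0 by (intro mult_left_mono mult_right_mono) (auto simp: abs_le_square_iff[symmetric])
      finally show ?thesis using e by simp
    qed
  qed
qed

text \<open>Integrates the deviation bound against the kernel; the exponential weight only lowers
  \<open>l\<close> by \<open>\<alpha> + \<omega>\<close> in the second moment.\<close>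

lemma norm_L_minus_le:
  assumes t: "t > 0" and q: "q > 0" and l: "l > \<alpha> + \<omega>" and K: "K \<ge> 0" and e: "e > 0"
    and f: "\<And>s. s \<ge> 0 \<Longrightarrow> norm (f s - f t) \<le> e + K * ((s - t)\<^sup>2 * exp ((\<alpha> + \<omega>) * s))"
  shows "norm (L q l - (fact q / l ^ Suc q) *\<^sub>R f t) \<le> e * (fact q / l ^ Suc q) +
    K * (fact q / (l - (\<alpha> + \<omega>)) ^ Suc q * ((real q + 1) * (real q + 2) / (l - (\<alpha> + \<omega>))\<^sup>2
      - 2 * t * (real q + 1) / (l - (\<alpha> + \<omega>)) + t\<^sup>2))"
    (is "_ \<le> ?R")
proof -
  have l0: "l > 0" "l > \<omega>" using l alpha omega by auto
  have p: "((\<lambda>s. s ^ q * exp (- l * s)) has_integral fact q / l ^ Suc q) {0..}"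
    by (rule has_integral_power_exp[OF l0(1) q])
  have "((\<lambda>s. (s ^ q * exp (- l * s)) *\<^sub>R f s - (s ^ q * exp (- l * s)) *\<^sub>R f t) has_integral
      L q l - (fact q / l ^ Suc q) *\<^sub>R f t) {0..}"
    unfolding L_def by (intro has_integral_diff has_integral_scaleR_left p integrable_integral integrable_L l0)
  moreover have "((\<lambda>s. e * (s ^ q * exp (- l * s)) +
      K * (s ^ q * (s - t)\<^sup>2 * exp (- (l - (\<alpha> + \<omega>)) * s))) has_integral ?R) {0..}"
    by (intro has_integral_add has_integral_mult_right p has_integral_quadratic_power_exp) (use l q in auto)
  moreover have "norm ((s ^ q * exp (- l * s)) *\<^sub>R f s - (s ^ q * exp (- l * s)) *\<^sub>R f t) \<le>
      e * (s ^ q * exp (- l * s)) + K * (s ^ q * (s - t)\<^sup>2 * exp (- (l - (\<alpha> + \<omega>)) * s))"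
    if s: "s \<ge> 0" for s
  proof -
    have "norm ((s ^ q * exp (- l * s)) *\<^sub>R f s - (s ^ q * exp (- l * s)) *\<^sub>R f t)
        = s ^ q * exp (- l * s) * norm (f s - f t)"
      using s by (simp add: abs_mult flip: scaleR_diff_right)
    also have "\<dots> \<le> s ^ q * exp (- l * s) * (e + K * ((s - t)\<^sup>2 * exp ((\<alpha> + \<omega>) * s)))"
      using s by (intro mult_left_mono f) auto
    also have "\<dots> = e * (s ^ q * exp (- l * s)) + K * (s ^ q * (s - t)\<^sup>2 * (exp (- l * s) * exp ((\<alpha> + \<omega>) * s)))"
      by (simp add: algebra_simps)
    also have "exp (- l * s) * exp ((\<alpha> + \<omega>) * s) = exp (- (l - (\<alpha> + \<omega>)) * s)"
      by (simp add: algebra_simps flip: exp_add)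
    finally show ?thesis .
  qed
  ultimately show ?thesis
    by (metis (no_types, lifting) atLeast_iff has_integral_iff integral_norm_bound_integral)
qed

lemma V_approximate_identity:
  assumes t: "t > 0"
  shows "(\<lambda>q. (real (q + k + 1) ^ (q + k + 1) / fact (q + k)) *\<^sub>R V (real (q + k + 1)) 0 q t) \<longlonglongrightarrow> f t"
proof -
  define b where "b = (\<alpha> + \<omega>) * t"
  define N where "N q = real (q + k + 1)" for q
  \<comment> \<open>\<open>A q\<close> is the full coefficient of \<open>L q (N q / t)\<close>. Then
    \<open>m q\<close> is the mass of the kernel, by \<open>A_l\<close>, and
    \<open>m q * G q\<close> its weighted second moment about \<open>t\<close>, by
    \<open>A_a\<close>.\<close>
  define A where "A q = N q ^ (q + k + 1) / fact (q + k) * inverse t ^ Suc q" for q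
  define m where "m q = N q ^ k * fact q / fact (q + k)" for q
  define G where "G q = (N q / (N q - b)) ^ Suc q * (t\<^sup>2 * ((real q + 1) * (real q + 2) / (N q - b)\<^sup>2
      - 2 * (real q + 1) / (N q - b) + 1))" for q
  have N: "N q > 0" for q by (simp add: N_def)
  have m_lim: "m \<longlonglongrightarrow> 1"
    unfolding m_def N_def using fact_ratio_tendsto[of k] by simp
  have r_lim: "(\<lambda>q. (N q / (N q - b)) ^ Suc q) \<longlonglongrightarrow> exp b"
    unfolding N_def by real_asymp
  \<comment> \<open>The summands tend to 1, -2 and 1, since \<open>N q\<close> differs from
    \<open>q\<close> by a constant.\<close>
  have "(\<lambda>q. (real q + 1) * (real q + 2) / (N q - b)\<^sup>2 - 2 * (real q + 1) / (N q - b) + 1) \<longlonglongrightarrow> 0"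
    unfolding N_def by real_asymp
  then have G_lim: "G \<longlonglongrightarrow> 0"
    unfolding G_def using tendsto_mult[OF r_lim tendsto_mult_right_zero[of _ _ "t\<^sup>2"]] by simp
  have A_l: "A q * (fact q / (N q / t) ^ Suc q) = m q" for q
  proof -
    have "N q ^ (q + k + 1) = N q ^ k * N q ^ Suc q"
      by (simp add: add.commute flip: power_add)
    then show ?thesis
      using N[of q] t by (simp add: A_def m_def power_divide power_inverse del: power_Suc)
  qed
  have A_a: "A q * (fact q / (N q / t - (\<alpha> + \<omega>)) ^ Suc q * ((real q + 1) * (real q + 2) / (N q / t - (\<alpha> + \<omega>))\<^sup>2
      - 2 * t * (real q + 1) / (N q / t - (\<alpha> + \<omega>)) + t\<^sup>2)) = m q * G q" if "N q > b" for q
  proof -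
    have a: "N q / t - (\<alpha> + \<omega>) = (N q - b) / t" using t by (simp add: b_def field_simps)
    have "(real q + 1) * (real q + 2) / ((N q - b) / t)\<^sup>2 - 2 * t * (real q + 1) / ((N q - b) / t) + t\<^sup>2
        = t\<^sup>2 * ((real q + 1) * (real q + 2) / (N q - b)\<^sup>2 - 2 * (real q + 1) / (N q - b) + 1)"
      using t by (simp add: power2_eq_square algebra_simps)
    moreover have "A q * (fact q / ((N q - b) / t) ^ Suc q) = m q * (N q / (N q - b)) ^ Suc q"
      unfolding A_l[symmetric] using t that N[of q] by (simp add: power_divide del: power_Suc)
    ultimately show ?thesis
      unfolding a G_def by (metis (no_types, lifting) mult.assoc)
  qed
  have V_eq: "(N q ^ (q + k + 1) / fact (q + k)) *\<^sub>R V (N q) 0 q t = A q *\<^sub>R L q (N q / t)" for q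
    by (simp add: V_def A_def)
  have A0: "A q \<ge> 0" for q using t N[of q] by (simp add: A_def)
  have "(\<lambda>q. A q *\<^sub>R L q (N q / t)) \<longlonglongrightarrow> f t"
  proof (rule tendstoI)
    fix r :: real assume r: "r > 0"
    obtain K where K: "K \<ge> 0" "\<And>s. s \<ge> 0 \<Longrightarrow>
        norm (f s - f t) \<le> r / 2 + K * ((s - t)\<^sup>2 * exp ((\<alpha> + \<omega>) * s))"
      using deviation_le[OF t, of "r / 2"] r by auto
    \<comment> \<open>The last summand pays for the mass being only asymptotically 1; the whole
      tends to \<open>r / 2\<close>.\<close>
    have "(\<lambda>q. r / 2 * m q + K * (m q * G q) + \<bar>m q - 1\<bar> * norm (f t))
        \<longlonglongrightarrow> r / 2 * 1 + K * (1 * 0) + \<bar>1 - 1\<bar> * norm (f t)"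
      by (intro tendsto_intros m_lim G_lim)
    from order_tendstoD(2)[OF this, of r]
    have "\<forall>\<^sub>F q in sequentially. r / 2 * m q + K * (m q * G q) + \<bar>m q - 1\<bar> * norm (f t) < r"
      using r by simp
    moreover have "\<forall>\<^sub>F q in sequentially. N q > b"
      unfolding N_def by real_asymp
    ultimately show "\<forall>\<^sub>F q in sequentially. dist (A q *\<^sub>R L q (N q / t)) (f t) < r"
      using eventually_gt_at_top[of 0]
    proof eventually_elim
      case (elim q)
      have l: "N q / t > \<alpha> + \<omega>" using elim t by (simp add: b_def field_simps)
      have "norm (A q *\<^sub>R (L q (N q / t) - (fact q / (N q / t) ^ Suc q) *\<^sub>R f t))
          = A q * norm (L q (N q / t) - (fact q / (N q / t) ^ Suc q) *\<^sub>R f t)"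
        using A0[of q] by simp
      also have "\<dots> \<le> A q * (r / 2 * (fact q / (N q / t) ^ Suc q) +
          K * (fact q / (N q / t - (\<alpha> + \<omega>)) ^ Suc q * ((real q + 1) * (real q + 2) / (N q / t - (\<alpha> + \<omega>))\<^sup>2
          - 2 * t * (real q + 1) / (N q / t - (\<alpha> + \<omega>)) + t\<^sup>2)))"
        by (rule mult_left_mono[OF norm_L_minus_le[OF t _ l K(1) _ K(2)] A0]) (use elim r in auto)
      also have "\<dots> = r / 2 * m q + K * (m q * G q)"
      proof -
        have "A q * (r / 2 * x + K * y) = r / 2 * (A q * x) + K * (A q * y)" for x y
          by (simp add: algebra_simps)
        then show ?thesis by (simp only: A_l A_a[OF elim(2)])
      qed
      also have "A q *\<^sub>R (L q (N q / t) - (fact q / (N q / t) ^ Suc q) *\<^sub>R f t)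
          = A q *\<^sub>R L q (N q / t) - m q *\<^sub>R f t"
        by (simp only: scaleR_diff_right scaleR_scaleR A_l)
      finally have 1: "norm (A q *\<^sub>R L q (N q / t) - m q *\<^sub>R f t) \<le> r / 2 * m q + K * (m q * G q)" .
      have "A q *\<^sub>R L q (N q / t) - f t = (A q *\<^sub>R L q (N q / t) - m q *\<^sub>R f t) + (m q - 1) *\<^sub>R f t"
        by (simp add: algebra_simps)
      then have "dist (A q *\<^sub>R L q (N q / t)) (f t)
          \<le> norm (A q *\<^sub>R L q (N q / t) - m q *\<^sub>R f t) + \<bar>m q - 1\<bar> * norm (f t)"
        unfolding dist_norm by (metis norm_scaleR norm_triangle_ineq)
      with 1 elim(1) show ?case by linarith
    qed
  qed
  then show ?thesis
    unfolding V_eq[symmetric] by (simp add: N_def)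
qed

end

section \<open>Powers of the resolvent family and the limit\<close>

lemma blinfun_funpow_scaleR:
  fixes T :: "'a::real_normed_vector \<Rightarrow>\<^sub>L 'a"
  shows "((\<lambda>y. c *\<^sub>R blinfun_apply T y) ^^ n) x = c ^ n *\<^sub>R (blinfun_apply T ^^ n) x"
  by (induction n) (auto simp: blinfun.bilinear_simps)

lemma indicator_scaleR_cong:
  fixes u v :: "'a::real_vector"
  assumes "t \<in> D \<Longrightarrow> u = v"
  shows "indicator D t *\<^sub>R u = indicator D t *\<^sub>R v"
  using assms by (cases "t \<in> D") auto

theorem theorem3p1:
  fixes S :: "real \<Rightarrow> 'a::banach \<Rightarrow>\<^sub>L 'a"
    and k :: nat and M \<alpha> \<omega> t\<^sub>0 :: real
  assumes "k \<ge> 1"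
    and "integrated_semigroup (real k) S"
    and "M > 0" and "\<omega> \<ge> 0"
    and "real k - 1 < \<alpha>" and "\<alpha> \<le> real k"
    and "\<And>t. t > 0 \<Longrightarrow> norm (S t) \<le> M * t powr \<alpha> * exp (\<omega> * t)"
    and "t\<^sub>0 > 0"
  shows "(\<forall>\<^sub>F n in sequentially. \<forall>x.
            Bochner_integrable_on (\<lambda>t. (resolvent_family k S (t / real n) ^^ n) x) {0<..<t\<^sub>0}) \<and>
         (\<forall>x. (\<lambda>n. Bochner_integral_on {0<..<t\<^sub>0}
                 (\<lambda>\<tau>. ((t\<^sub>0 - \<tau>) ^ (k - 1) / fact (k - 1)) *\<^sub>R
                        (resolvent_family k S (\<tau> / real n) ^^ n) x))
              \<longlonglongrightarrow> blinfun_apply (S t\<^sub>0) x)"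
proof -
  note k = assms(1) and M = assms(3) and omega = assms(4) and alpha_gt = assms(5)
    and bound = assms(7) and t0 = assms(8)
  have alpha: "\<alpha> > 0" using k alpha_gt by linarith
  obtain A where "generates_integrated_semigroup (real k) A S"
    using assms(2) unfolding integrated_semigroup_def by blast
  then obtain w0 where cont: "\<And>x. continuous_on {0..} (\<lambda>t. blinfun_apply (S t) x)"
    and w0: "w0 \<ge> 0" "{w0<..} \<subseteq> resolvent_set A"
    and res: "\<And>l x. l > w0 \<Longrightarrow> blinfun_apply (resolvent l A) x = l powr real k *\<^sub>R Laplace_transform S l x"
    unfolding generates_integrated_semigroup_def by blast
  \<comment> \<open>The norm bound is assumed for t > 0 only; strong continuity carries it to t = 0,
    as the locale requires.\<close>
  have S0: "blinfun_apply (S 0) x = 0" for x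
  proof -
    have lim: "(\<lambda>n. 1 / real (Suc n)) \<longlonglongrightarrow> 0" by real_asymp
    have "(\<lambda>n. blinfun_apply (S (1 / real (Suc n))) x) \<longlonglongrightarrow> blinfun_apply (S 0) x"
      by (rule continuous_on_tendsto_compose[OF cont lim]) auto
    moreover have "(\<lambda>n. blinfun_apply (S (1 / real (Suc n))) x) \<longlonglongrightarrow> 0"
    proof (rule Lim_null_comparison)
      show "\<forall>\<^sub>F n in sequentially. norm (blinfun_apply (S (1 / real (Suc n))) x)
          \<le> M * (1 / real (Suc n)) powr \<alpha> * exp (\<omega> * (1 / real (Suc n))) * norm x"
        by (intro always_eventually allI order_trans[OF norm_blinfun] mult_right_mono bound) auto
      have "(\<lambda>n. (1 / real (Suc n)) powr \<alpha> * exp (\<omega> * (1 / real (Suc n)))) \<longlonglongrightarrow> 0"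
        using alpha by real_asymp
      then have "(\<lambda>n. M * ((1 / real (Suc n)) powr \<alpha> * exp (\<omega> * (1 / real (Suc n)))) * norm x) \<longlonglongrightarrow> 0"
        by (intro tendsto_mult_left_zero tendsto_mult_right_zero)
      then show "(\<lambda>n. M * (1 / real (Suc n)) powr \<alpha> * exp (\<omega> * (1 / real (Suc n))) * norm x) \<longlonglongrightarrow> 0"
        by (simp only: mult.assoc)
    qed
    ultimately show ?thesis by (rule LIMSEQ_unique)
  qed
  have growth: "laplace_growth (\<lambda>t. blinfun_apply (S t) x) (M * norm x) \<alpha> \<omega>" for x
  proof
    fix t :: real assume t: "t \<ge> 0"
    show "norm (blinfun_apply (S t) x) \<le> M * norm x * t powr \<alpha> * exp (\<omega> * t)"
    proof (cases "t = 0")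
      case False
      with t have "norm (blinfun_apply (S t) x) \<le> M * t powr \<alpha> * exp (\<omega> * t) * norm x"
        by (intro order_trans[OF norm_blinfun] mult_right_mono bound) auto
      then show ?thesis by (simp add: mult_ac)
    qed (simp add: S0)
  qed (use cont alpha M omega in auto)
  \<comment> \<open>The resolvent identity is only available beyond \<open>w0\<close>, which may exceed \<open>\<omega>\<close>; large \<open>n\<close>
    push \<open>n / t\<close> beyond both.\<close>
  define w where "w = max w0 \<omega>"
  define T where "T l = resolvent l A" for l
  have T_eq: "T m - T l = (l - m) *\<^sub>R (T l o\<^sub>L T m)" if "l > w" "m > w" for l m
    unfolding T_def using that w0(2)
    by (intro resolvent_equation[of l A] is_resolvent_at_resolvent) (auto simp: w_def)
  \<comment> \<open>Identifies the Bochner integral of the definition with the Henstock-Kurzweil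
    integral \<open>L\<close>.\<close>
  have Laplace: "Laplace_transform S l x = laplace_growth.L (\<lambda>t. blinfun_apply (S t) x) 0 l" if "l > w" for l x
    unfolding Laplace_transform_def
    using laplace_growth.Bochner_L[OF growth, of l 0 x] that by (intro Bochner_integral_eq) (auto simp: w_def)
  have T_L: "blinfun_apply (T l) x = l ^ k *\<^sub>R laplace_growth.L (\<lambda>t. blinfun_apply (S t) x) 0 l" if "l > w" for l x
    using that w0(1) unfolding T_def by (simp add: res Laplace powr_realpow w_def)
  \<comment> \<open>Writing n = q + k + 1 makes this n^n / (n - 1)! and lets the k-fold
    antiderivative have index \<open>q\<close>, without truncated subtraction.\<close>
  define r where "r q = real (q + k + 1) ^ (q + k + 1) / fact (q + k)" for q
  have family: "(resolvent_family k S (t / real (q + k + 1)) ^^ (q + k + 1)) x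
      = r q *\<^sub>R laplace_growth.V (\<lambda>t. blinfun_apply (S t) x) (real (q + k + 1)) k (q + k) t"
    if "t > 0" "real (q + k + 1) / t > w" for q t x
  proof -
    interpret laplace_growth "\<lambda>t. blinfun_apply (S t) x" "M * norm x" \<alpha> \<omega>
      by (rule growth)
    let ?l = "real (q + k + 1) / t"
    \<comment> \<open>Beyond \<open>w\<close> the family is \<open>?l\<close> times a bounded linear
      resolvent, so the scalars can be pulled out of the iterates.\<close>
    have "resolvent_family k S (t / real (q + k + 1)) = (\<lambda>y. ?l *\<^sub>R blinfun_apply (T ?l) y)"
      using that by (auto simp: resolvent_family_def assoc_pseudo_resolvent_def T_L Laplace)
    then have "(resolvent_family k S (t / real (q + k + 1)) ^^ (q + k + 1)) x
        = ?l ^ (q + k + 1) *\<^sub>R (blinfun_apply (T ?l) ^^ Suc (q + k)) x"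
      by (simp only: blinfun_funpow_scaleR Suc_eq_plus1)
    also have "(blinfun_apply (T ?l) ^^ Suc (q + k)) x = (1 / fact (q + k)) *\<^sub>R P k (q + k) ?l"
      using P_eq_resolvent_power[of w T x k ?l "q + k", OF T_eq _ T_L that(2)]
      by (simp add: w_def del: funpow.simps)
    also have "?l ^ (q + k + 1) *\<^sub>R (1 / fact (q + k)) *\<^sub>R P k (q + k) ?l
        = r q *\<^sub>R V (real (q + k + 1)) k (q + k) t"
      by (simp add: V_def r_def power_mult_distrib power_inverse divide_inverse del: power_Suc)
    finally show ?thesis .
  qed
  \<comment> \<open>The first condition serves the resolvent identity, the second the bounds on
    \<open>V\<close>. Imposed at \<open>t\<^sub>0\<close>, they hold at every smaller t > 0. Neither
    involves \<open>x\<close>, so one threshold for n serves all vectors.\<close>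
  have large: "\<forall>\<^sub>F q in sequentially. real (q + k + 1) / t\<^sub>0 > w \<and> real (q + k + 1) / t\<^sub>0 \<ge> 2 * \<omega>"
  proof (rule eventually_conj)
    show "\<forall>\<^sub>F q in sequentially. real (q + k + 1) / t\<^sub>0 > w" using t0 by real_asymp
    show "\<forall>\<^sub>F q in sequentially. real (q + k + 1) / t\<^sub>0 \<ge> 2 * \<omega>" using t0 by real_asymp
  qed
  have family_in: "(resolvent_family k S (t / real (q + k + 1)) ^^ (q + k + 1)) x
      = r q *\<^sub>R laplace_growth.V (\<lambda>t. blinfun_apply (S t) x) (real (q + k + 1)) k (q + k) t"
    if "real (q + k + 1) / t\<^sub>0 > w" "t \<in> {0<..<t\<^sub>0}" for q t x
    using that by (intro family less_le_trans[OF that(1)] divide_left_mono) auto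
  show ?thesis
  proof (intro conjI allI)
    have "\<forall>\<^sub>F q in sequentially. \<forall>x.
        Bochner_integrable_on (\<lambda>t. (resolvent_family k S (t / real (q + (k + 1))) ^^ (q + (k + 1))) x) {0<..<t\<^sub>0}"
      using large
    proof (eventually_elim, intro allI)
      fix q x assume q: "real (q + k + 1) / t\<^sub>0 > w \<and> real (q + k + 1) / t\<^sub>0 \<ge> 2 * \<omega>"
      interpret laplace_growth "\<lambda>t. blinfun_apply (S t) x" "M * norm x" \<alpha> \<omega>
        by (rule growth)
      obtain I where "Bochner_has_integral lborel
          (\<lambda>t. indicator {0<..<t\<^sub>0} t *\<^sub>R r q *\<^sub>R V (real (q + k + 1)) k (q + k) t) I"
        by (rule Bochner_V[of "real (q + k + 1)" t\<^sub>0 k "\<lambda>_. r q" "\<bar>r q\<bar>" "q + k"])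
          (use q t0 alpha_gt in auto)
      moreover have "(\<lambda>t. indicator {0<..<t\<^sub>0} t *\<^sub>R r q *\<^sub>R V (real (q + k + 1)) k (q + k) t)
          = (\<lambda>t. indicator {0<..<t\<^sub>0} t *\<^sub>R (resolvent_family k S (t / real (q + k + 1)) ^^ (q + k + 1)) x)"
        by (intro ext indicator_scaleR_cong) (simp only: family_in[OF conjunct1[OF q]])
      ultimately show "Bochner_integrable_on
          (\<lambda>t. (resolvent_family k S (t / real (q + (k + 1))) ^^ (q + (k + 1))) x) {0<..<t\<^sub>0}"
        unfolding Bochner_integrable_def by (auto simp only: add.assoc)
    qed
    then show "\<forall>\<^sub>F n in sequentially. \<forall>x.
        Bochner_integrable_on (\<lambda>t. (resolvent_family k S (t / real n) ^^ n) x) {0<..<t\<^sub>0}"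
      by (rule eventually_sequentially_seg[THEN iffD1])
  next
    fix x
    interpret laplace_growth "\<lambda>t. blinfun_apply (S t) x" "M * norm x" \<alpha> \<omega>
      by (rule growth)
    let ?c = "\<lambda>t. (t\<^sub>0 - t) ^ (k - 1) / fact (k - 1)"
    have "\<forall>\<^sub>F q in sequentially. r q *\<^sub>R V (real (q + k + 1)) 0 q t\<^sub>0 =
        Bochner_integral_on {0<..<t\<^sub>0}
          (\<lambda>t. ?c t *\<^sub>R (resolvent_family k S (t / real (q + (k + 1))) ^^ (q + (k + 1))) x)"
      using large
    proof eventually_elim
      case (elim q)
      have "Bochner_has_integral lborel
          (\<lambda>t. indicator {0<..<t\<^sub>0} t *\<^sub>R ?c t *\<^sub>R r q *\<^sub>R V (real (q + k + 1)) k (q + k) t)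
          (r q *\<^sub>R V (real (q + k + 1)) 0 q t\<^sub>0)"
        by (rule Bochner_Taylor_V) (use elim t0 alpha_gt k in auto)
      moreover have "(\<lambda>t. indicator {0<..<t\<^sub>0} t *\<^sub>R ?c t *\<^sub>R r q *\<^sub>R V (real (q + k + 1)) k (q + k) t)
          = (\<lambda>t. indicator {0<..<t\<^sub>0} t *\<^sub>R ?c t *\<^sub>R
              (resolvent_family k S (t / real (q + k + 1)) ^^ (q + k + 1)) x)"
        by (intro ext indicator_scaleR_cong) (simp only: family_in[OF conjunct1[OF elim]])
      ultimately show ?case
        by (simp only: Bochner_integral_eq add.assoc)
    qed
    moreover have "(\<lambda>q. r q *\<^sub>R V (real (q + k + 1)) 0 q t\<^sub>0) \<longlonglongrightarrow> blinfun_apply (S t\<^sub>0) x"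
      unfolding r_def by (rule V_approximate_identity[OF t0])
    ultimately have "(\<lambda>q. Bochner_integral_on {0<..<t\<^sub>0}
          (\<lambda>t. ?c t *\<^sub>R (resolvent_family k S (t / real (q + (k + 1))) ^^ (q + (k + 1))) x))
        \<longlonglongrightarrow> blinfun_apply (S t\<^sub>0) x"
      by (rule Lim_transform_eventually[rotated])
    then show "(\<lambda>n. Bochner_integral_on {0<..<t\<^sub>0}
          (\<lambda>t. ?c t *\<^sub>R (resolvent_family k S (t / real n) ^^ n) x)) \<longlonglongrightarrow> blinfun_apply (S t\<^sub>0) x"
      by (rule LIMSEQ_offset)
  qed
qed

end
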